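(* Let $s>0$ and $f\in X^s$. Then the error $E_n^G[f]=\int_{-1}^1 f(x)\,dx-I_n^G[f]$ of the $n$-point Gauss-Legendre quadrature rule satisfies, as $n\to\infty$, $$E_n^G[f]=\begin{cases}O(n^{-2s}), & 0<s<1,\\ O(n^{-2}\ln n), & s=1,\\ O(n^{-s-1}), & s>1.\end{cases}$$
   Context: For $f$ on $[-1,1]$ the Chebyshev coefficients are $a_j=\frac{2}{\pi}\int_{-1}^1\frac{f(x)T_j(x)}{\sqrt{1-x^2}}\,dx$, $j=0,1,\dots$, where $T_j(x)=\cos(j\cos^{-1}x)$. One says $f\in X^s$ ($s>0$) if $a_j=O(j^{-s-1})$ as $j\to\infty$. Functions $f$ are assumed to be the sum of their uniformly convergent Chebyshev series, $f(x)=\frac{a_0}{2}+\sum_{j=1}^\infty a_jT_j(x)$ on $[-1,1]$ (equivalently, for $f\in X^s$, $f$ is continuous). The $n$-point Gauss-Legendre rule is $I_n^G[f]=\sum_{k=1}^n w_kf(x_k)$, with $x_k$ the zeros of the degree-$n$ Legendre polynomial and $w_k$ the corresponding Gauss weights for the weight function $w(x)\equiv1$ on $[-1,1]$. *)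

theory Defs
  imports
    "HOL-Analysis.Analysis"
    "HOL-Computational_Algebra.Polynomial"
    "HOL-Library.Landau_Symbols"
begin

definition cheb_T :: "nat \<Rightarrow> real \<Rightarrow> real" where
  "cheb_T j x = cos (real j * arccos x)"

text \<open>At the endpoints \<open>x = 1\<close> and \<open>x = -1\<close> the integrand takes the value 0, because division by
  zero yields 0; this does not affect the integral.\<close>

definition cheb_integrand :: "(real \<Rightarrow> real) \<Rightarrow> nat \<Rightarrow> real \<Rightarrow> real" where
  "cheb_integrand f j x = f x * cheb_T j x / sqrt (1 - x\<^sup>2)"

definition cheb_coeff :: "(real \<Rightarrow> real) \<Rightarrow> nat \<Rightarrow> real" where
  "cheb_coeff f j = 2 / pi * integral {-1..1} (cheb_integrand f j)"

text \<open>The integrability condition says that the Chebyshev coefficients exist; without it, the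
  default value 0 of \<open>integral\<close> would admit spurious elements.\<close>

definition X_space :: "real \<Rightarrow> (real \<Rightarrow> real) set" where
  "X_space s = {f. (\<forall>j. cheb_integrand f j integrable_on {-1..1}) \<and>
                   cheb_coeff f \<in> O(\<lambda>j. real j powr (- s - 1))}"

definition cheb_partial_sum :: "(real \<Rightarrow> real) \<Rightarrow> nat \<Rightarrow> real \<Rightarrow> real" where
  "cheb_partial_sum f N x = cheb_coeff f 0 / 2 + (\<Sum>j=1..N. cheb_coeff f j * cheb_T j x)"

definition is_sum_of_cheb_series :: "(real \<Rightarrow> real) \<Rightarrow> bool" where
  "is_sum_of_cheb_series f \<longleftrightarrow> uniform_limit {-1..1} (cheb_partial_sum f) f sequentially"

text \<open>Rodrigues' formula: \<open>P\<^sub>n\<close> is the \<open>n\<close>-th derivative of \<open>(x\<^sup>2 - 1)\<^sup>n\<close> divided by \<open>2\<^sup>n n!\<close>.\<close>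

definition legendre_poly :: "nat \<Rightarrow> real poly" where
  "legendre_poly n = smult (1 / (2 ^ n * fact n)) ((pderiv ^^ n) ([:-1, 0, 1:] ^ n))"

text \<open>The zeros are all real and simple, so the \<open>n\<close> nodes are given as a set rather than as an
  enumerated family.\<close>

definition gauss_nodes :: "nat \<Rightarrow> real set" where
  "gauss_nodes n = {x. poly (legendre_poly n) x = 0}"

text \<open>The weight of the node \<open>t\<close> is the integral of the Lagrange basis polynomial at \<open>t\<close> with
  respect to the weight function 1.\<close>

definition gauss_weight :: "nat \<Rightarrow> real \<Rightarrow> real" where
  "gauss_weight n t = integral {-1..1} (\<lambda>x. \<Prod>u\<in>gauss_nodes n - {t}. (x - u) / (t - u))"

definition gauss_rule :: "nat \<Rightarrow> (real \<Rightarrow> real) \<Rightarrow> real" where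
  "gauss_rule n f = (\<Sum>t\<in>gauss_nodes n. gauss_weight n t * f t)"

definition gauss_error :: "nat \<Rightarrow> (real \<Rightarrow> real) \<Rightarrow> real" where
  "gauss_error n f = integral {-1..1} f - gauss_rule n f"

end

theory Submission
  imports Defs
begin

text \<open>
  The rule with \<open>n\<close> nodes integrates polynomials of degree below \<open>2 n\<close> exactly, so the error at \<open>f\<close> is
  \<open>\<Sum>\<^bsub>j \<ge> 2 n\<^esub> a\<^sub>j E\<^sub>n[T\<^sub>j]\<close>. The trivial bound \<open>E\<^sub>n[T\<^sub>j] = O(1)\<close> only gives \<open>O(n\<^bsup>-s\<^esup>)\<close>;
  the additional decay comes from the fact that \<open>E\<^sub>n[T\<^sub>j]\<close> is large for few \<open>j\<close> only.

  To see this, the nodes \<open>t = cos \<theta>\<close> are compared with the equidistant angles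
  \<open>\<phi>\<^sub>k = (k - 1/4) \<pi> / \<nu>\<close>, where \<open>\<nu> = n + 1/2\<close>. The function \<open>u(\<theta>) = sqrt (sin \<theta>) P\<^sub>n(cos \<theta>)\<close> satisfies
  \<open>u'' + (\<nu>\<^sup>2 + 1/(4 sin\<^sup>2 \<theta>)) u = 0\<close>, a small perturbation of the harmonic oscillator. In polar
  (Pruefer) coordinates of \<open>(u, u'/\<nu>)\<close> the perturbation changes the phase and the logarithm of the
  squared amplitude by at most \<open>|cot \<theta>| / (4 \<nu>)\<close>, counted from the midpoint \<open>\<pi>/2\<close>, where parity fixes the
  phase exactly. The phase yields \<open>|\<theta> - \<phi>\<^sub>k| \<le> 1 / (4 \<nu>\<^sup>2 sin \<theta>)\<close> (\<open>gauss_nodes_index\<close>). The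
  amplitude yields the weights, since \<open>w\<^sub>t = 2 / ((1 - t\<^sup>2) P\<^sub>n'(t)\<^sup>2) = 2 sin \<theta> / u'(\<theta>)\<^sup>2\<close>: they are
  \<open>\<kappa> sin \<theta>\<close> up to \<open>O(\<kappa>/n)\<close> with one constant \<open>\<kappa> = O(1/n)\<close> (\<open>gauss_weight_bounds\<close>).

  Replacing nodes and weights by \<open>\<phi>\<^sub>k\<close> and \<open>\<kappa> sin \<phi>\<^sub>k\<close> in the quadrature sum of \<open>T\<^sub>m\<close> costs
  \<open>O(m/n\<^sup>2)\<close> and leaves \<open>\<kappa> S\<^sub>m\<close> with \<open>S\<^sub>m = \<Sum>\<^sub>k sin \<phi>\<^sub>k cos (m \<phi>\<^sub>k)\<close> (\<open>gauss_rule_cheb_T_alias\<close>). The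
  sums \<open>S\<^sub>m\<close> are periodic up to sign with period \<open>4 n + 2\<close>, and within a period their absolute values
  add up to \<open>O(n)\<close> only, because \<open>S\<^sub>m\<close> is mostly a difference of consecutive values of a monotone
  function (\<open>sum_alias_period\<close>). Together with \<open>|a\<^sub>m| = O(m\<^bsup>-s-1\<^esup>)\<close> the terms \<open>\<kappa> S\<^sub>m\<close> contribute
  \<open>O(n\<^bsup>-s-1\<^esup>)\<close>. The remaining terms are bounded by \<open>m/n\<^sup>2\<close> for \<open>m \<le> n\<^sup>2\<close> and by a constant for \<open>m > n\<^sup>2\<close>:
  they contribute \<open>n\<^bsup>-2\<^esup> \<Sum>\<^bsub>n < m \<le> n\<^sup>2\<^esub> m\<^bsup>-s\<^esup> + O(n\<^bsup>-2s\<^esup>)\<close>, and the behaviour of this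
  sum for \<open>s < 1\<close>, \<open>s = 1\<close> and \<open>s > 1\<close> produces the three cases.
\<close>

section \<open>Legendre polynomials\<close>

lemma integrable_poly: "poly (p::real poly) integrable_on {a..b}"
  by (intro integrable_continuous_interval continuous_intros)

lemma integral_pderiv:
  "integral {-1..1} (poly (pderiv p)) = poly p 1 - poly p (-1::real)"
  by (intro integral_unique fundamental_theorem_of_calculus)
     (auto simp: has_real_derivative_iff_has_vector_derivative[symmetric]
       intro!: DERIV_subset[OF poly_DERIV])

lemma integral_poly_add:
  "integral {-1..1} (poly (p + q)) =
    integral {-1..1} (poly p) + integral {-1..1} (poly (q::real poly))"
  using integral_add[OF integrable_poly[of p "-1" 1] integrable_poly[of q "-1" 1]]
  by (simp add: poly_add[abs_def])

lemma integral_poly_smult: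
  "integral {-1..1} (poly (smult c p)) = c * integral {-1..1} (poly (p::real poly))"
  by (simp add: poly_smult[abs_def])

lemma integral_by_parts_poly:
  "integral {-1..1} (poly (pderiv p * q)) =
     poly p 1 * poly q 1 - poly p (-1) * poly q (-1)
     - integral {-1..1} (poly (p * pderiv (q::real poly)))"
proof -
  have "integral {-1..1} (poly (pderiv (p * q))) =
    integral {-1..1} (poly (p * pderiv q)) + integral {-1..1} (poly (pderiv p * q))"
    by (simp only: pderiv_mult integral_poly_add mult.commute[of q])
  then show ?thesis
    by (simp add: integral_pderiv)
qed

lemma pderiv_linear_power_mult:
  "pderiv ([:-a, 1:] ^ Suc n * q) =
     [:-a, 1:] ^ n * (smult (of_nat (Suc n)) q + [:-a, 1:] * pderiv (q::real poly))"
  unfolding pderiv_mult pderiv_power_Suc by (simp add: pderiv_pCons algebra_simps)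

lemma higher_pderiv_linear_power_below:
  "k < n \<Longrightarrow> poly ((pderiv ^^ k) ([:-a, 1:] ^ n * q)) (a::real) = 0"
proof (induction k arbitrary: n q)
  case 0
  then show ?case by simp
next
  case (Suc k)
  then obtain m where "n = Suc m" "k < m" by (cases n) auto
  with Suc.IH show ?case
    by (simp add: funpow_Suc_right pderiv_linear_power_mult del: funpow.simps power_Suc)
qed

text \<open>Only the terms of the Leibniz rule that differentiate the power \<open>n\<close> times survive at \<open>a\<close>. This
  gives the values of the Legendre polynomials at the endpoints.\<close>

lemma higher_pderiv_linear_power_at:
  "poly ((pderiv ^^ n) ([:-a, 1:] ^ n * q)) (a::real) = fact n * poly q a"
proof (induction n arbitrary: q)
  case (Suc n)
  then have "poly ((pderiv ^^ Suc n) ([:-a, 1:] ^ Suc n * q)) a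
      = fact n * poly (smult (of_nat (Suc n)) q + [:-a, 1:] * pderiv q) a"
    by (simp only: funpow_Suc_right o_apply pderiv_linear_power_mult)
  also have "\<dots> = fact (Suc n) * poly q a" by (simp add: algebra_simps)
  finally show ?case .
qed simp

lemma quadratic_power: "[:-1, 0, 1:] ^ n = [:-1, 1:] ^ n * [:-(-1), 1::real:] ^ n"
proof -
  have "[:-1, 0, 1:] = [:-1, 1:] * [:-(-1), 1::real:]" by simp
  then show ?thesis by (metis power_mult_distrib)
qed

text \<open>These vanishing boundary values make \<open>n\<close> integrations by parts possible in Rodrigues' formula,
  and they supply the two extra zeros in each application of Rolle's theorem.\<close>

lemma rodrigues_boundary:
  assumes "k < n"
  shows "poly ((pderiv ^^ k) ([:-1, 0, 1:] ^ n)) (1::real) = 0"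
    and "poly ((pderiv ^^ k) ([:-1, 0, 1:] ^ n)) (-1::real) = 0"
  using higher_pderiv_linear_power_below[OF assms, of 1 "[:1, 1:] ^ n"]
    higher_pderiv_linear_power_below[OF assms, of "-1" "[:-1, 1:] ^ n"]
  by (simp_all add: quadratic_power mult.commute)

lemma legendre_at_1: "poly (legendre_poly n) 1 = 1"
  using higher_pderiv_linear_power_at[of n 1 "[:1, 1:] ^ n"]
  by (simp add: legendre_poly_def quadratic_power)

lemma legendre_at_minus_1: "poly (legendre_poly n) (-1) = (-1) ^ n"
  using higher_pderiv_linear_power_at[of n "-1" "[:-1, 1:] ^ n"]
  by (simp add: legendre_poly_def quadratic_power mult.commute[of "[:-1,1:]^n"])
     (simp add: power_divide[symmetric] del: power_divide)

lemma higher_pderiv_reflect: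
  "(pderiv ^^ k) (pcompose p [:0, -1:]) = smult ((-1) ^ k) (pcompose ((pderiv ^^ k) p) [:0, -1::real:])"
  by (induction k)
     (simp_all add: pderiv_smult pderiv_pcompose pderiv_pCons)

lemma legendre_reflect: "poly (legendre_poly n) (-x) = (-1) ^ n * poly (legendre_poly n) x"
proof -
  have "pcompose ([:-1, 0, 1:] ^ n) [:0, -1::real:] = [:-1, 0, 1:] ^ n"
    by (induction n)
       (simp_all add: pcompose_mult pcompose_pCons pcompose_1 del: mult_pCons_left)
  then have "(pderiv ^^ n) ([:-1, 0, 1::real:] ^ n)
      = smult ((-1) ^ n) (pcompose ((pderiv ^^ n) ([:-1, 0, 1:] ^ n)) [:0, -1:])"
    using higher_pderiv_reflect[of n "[:-1, 0, 1:] ^ n"] by simp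
  from arg_cong[OF this, where f = "\<lambda>p. poly p (-x)"]
  have "poly ((pderiv ^^ n) ([:-1, 0, 1::real:] ^ n)) (-x)
      = (-1) ^ n * poly ((pderiv ^^ n) ([:-1, 0, 1:] ^ n)) x"
    by (simp only: poly_smult poly_pcompose) simp
  then show ?thesis
    by (simp add: legendre_poly_def)
qed

lemma legendre_orthogonal:
  assumes "degree q < n"
  shows "integral {-1..1} (poly (legendre_poly n * q)) = 0"
proof -
  define u where "u = ([:-1, 0, 1:] ^ n :: real poly)"
  have "integral {-1..1} (poly ((pderiv ^^ k) u * q)) = 0" if "k \<le> n" "degree q < k \<or> q = 0" for k q
    using that
  proof (induction k arbitrary: q)
    case (Suc k)
    have "degree (pderiv q) < k \<or> pderiv q = 0"
      using Suc.prems by (auto simp: degree_pderiv pderiv_eq_0_iff)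
    then have "integral {-1..1} (poly ((pderiv ^^ k) u * pderiv q)) = 0"
      using Suc.IH[of "pderiv q"] Suc.prems(1) by (simp only: Suc_leD)
    moreover have "poly ((pderiv ^^ k) u) 1 = 0" "poly ((pderiv ^^ k) u) (-1) = 0"
      using rodrigues_boundary[of k n] Suc.prems by (simp_all add: u_def)
    ultimately show ?case
      by (simp only: funpow.simps o_apply integral_by_parts_poly)
  qed (auto simp: poly_0[abs_def])
  from this[of n q] assms show ?thesis
    by (simp add: legendre_poly_def u_def integral_poly_smult)
qed

text \<open>The Leibniz rule for a linear, and below for a quadratic, first factor breaks off; this is
  the form in which the differential equation of the Legendre polynomials is derived.\<close>

lemma higher_pderiv_X_mult:
  "(pderiv ^^ Suc k) ([:0, 1:] * v) =
     [:0, 1:] * (pderiv ^^ Suc k) v + smult (real (Suc k)) ((pderiv ^^ k) v)"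
proof (induction k)
  case 0
  then show ?case by (simp add: pderiv_mult pderiv_pCons)
next
  case (Suc k)
  show ?case
    by (subst funpow.simps(2), subst o_apply, subst Suc)
       (simp add: pderiv_mult pderiv_add pderiv_smult pderiv_pCons algebra_simps
         smult_add_left numeral_poly)
qed

lemma higher_pderiv_quadratic_mult:
  "(pderiv ^^ Suc (Suc k)) ([:-1, 0, 1:] * v) =
     [:-1, 0, 1:] * (pderiv ^^ Suc (Suc k)) v
     + smult (2 * real (k + 2)) ([:0, 1:] * (pderiv ^^ Suc k) v)
     + smult (real (k + 2) * real (k + 1)) ((pderiv ^^ k) v)"
proof -
  have 1: "[:-1, 0, 1:] * v = [:0, 1:] * ([:0, 1:] * v) - v" by simp
  have 2: "[:-1, 0, 1:] * w = [:0, 1:] * ([:0, 1:] * w) - w" for w :: "real poly" by simp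
  have diff: "(pderiv ^^ j) (p - q) = (pderiv ^^ j) p - (pderiv ^^ j) q" for j and p q :: "real poly"
    by (induction j) (simp_all add: pderiv_diff)
  have "(pderiv ^^ Suc (Suc k)) ([:-1, 0, 1:] * v) =
     [:0, 1:] * ([:0, 1:] * (pderiv ^^ Suc (Suc k)) v + smult (real (Suc (Suc k))) ((pderiv ^^ Suc k) v))
     + smult (real (Suc (Suc k))) ([:0, 1:] * (pderiv ^^ Suc k) v + smult (real (Suc k)) ((pderiv ^^ k) v))
     - (pderiv ^^ Suc (Suc k)) v"
    unfolding 1 diff higher_pderiv_X_mult ..
  then show ?thesis
    unfolding 2 poly_eq_poly_eq_iff[symmetric]
    by (auto simp add: fun_eq_iff algebra_simps)
qed

text \<open>The function \<open>u = (x\<^sup>2 - 1)\<^sup>n\<close> satisfies \<open>(x\<^sup>2 - 1) u' = 2 n x u\<close>; differentiating this identity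
  \<open>n + 1\<close> times gives Legendre's equation for the \<open>n\<close>-th derivative of \<open>u\<close>.\<close>

lemma legendre_ode:
  "(x\<^sup>2 - 1) * poly (pderiv (pderiv (legendre_poly n))) x + 2 * x * poly (pderiv (legendre_poly n)) x
     = real n * (real n + 1) * poly (legendre_poly n) x"
proof (cases n)
  case 0
  then show ?thesis by (simp add: legendre_poly_def)
next
  case (Suc m)
  define u where "u = ([:-1, 0, 1:] ^ n :: real poly)"
  have "[:-1, 0, 1:] * pderiv u = smult (2 * real n) ([:0, 1:] * u)"
    unfolding u_def Suc pderiv_power_Suc by (simp add: pderiv_pCons algebra_simps)
  then have "(pderiv ^^ Suc n) ([:-1, 0, 1:] * pderiv u)
      = (pderiv ^^ Suc n) (smult (2 * real n) ([:0, 1:] * u))" by simp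
  then have "poly ((pderiv ^^ Suc (Suc m)) ([:-1, 0, 1:] * pderiv u)) x
      = poly (smult (2 * real n) ((pderiv ^^ Suc n) ([:0, 1:] * u))) x"
    by (simp only: higher_pderiv_smult Suc)
  moreover have "(pderiv ^^ k) (pderiv u) = (pderiv ^^ Suc k) u" for k
    by (simp add: funpow_Suc_right del: funpow.simps)
  ultimately have "(x\<^sup>2 - 1) * poly ((pderiv ^^ Suc (Suc n)) u) x + 2 * x * poly ((pderiv ^^ Suc n) u) x
     = real n * (real n + 1) * poly ((pderiv ^^ n) u) x"
    unfolding higher_pderiv_quadratic_mult higher_pderiv_X_mult
    by (simp add: Suc algebra_simps power2_eq_square del: funpow.simps)
  then have "c * ((x\<^sup>2 - 1) * poly ((pderiv ^^ Suc (Suc n)) u) x + 2 * x * poly ((pderiv ^^ Suc n) u) x)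
     = c * (real n * (real n + 1) * poly ((pderiv ^^ n) u) x)" for c by simp
  from this[of "1 / (2 ^ n * fact n)"] show ?thesis
    by (simp add: legendre_poly_def u_def pderiv_smult algebra_simps add_divide_distrib diff_divide_distrib)
qed

lemma Rolle_finite:
  fixes p :: "real poly"
  assumes "finite S" "S \<noteq> {}" "\<And>x. x \<in> S \<Longrightarrow> poly p x = 0"
  shows "\<exists>R. finite R \<and> card R = card S - 1 \<and> (\<forall>x\<in>R. Min S < x \<and> x < Max S \<and> poly (pderiv p) x = 0)"
  using assms
proof (induction S rule: finite_linorder_max_induct)
  case empty
  then show ?case by simp
next
  case (insert b A)
  show ?case
  proof (cases "A = {}")
    case True
    then show ?thesis by (intro exI[of _ "{}"]) auto
  next
    case False
    from insert False obtain R where R: "finite R" "card R = card A - 1"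
      "\<forall>x\<in>R. Min A < x \<and> x < Max A \<and> poly (pderiv p) x = 0" by auto
    have "Max A < b" using insert False by simp
    have "poly p (Max A) = 0" using insert.prems(2) Max_in[OF \<open>finite A\<close> False] by auto
    with insert.prems poly_MVT[OF \<open>Max A < b\<close>, of p] obtain z where
      z: "Max A < z" "z < b" "poly (pderiv p) z = 0" by auto
    have "Min A \<le> Max A" using insert False by simp
    have [simp]: "Max (insert b A) = b"
      using \<open>Max A < b\<close> Max_insert[OF insert.hyps(1) False, of b] by linarith
    have [simp]: "Min (insert b A) = Min A"
      using \<open>Max A < b\<close> \<open>Min A \<le> Max A\<close> Min_insert[OF insert.hyps(1) False, of b] by linarith
    have "z \<notin> R" using R z by force
    moreover have "card A > 0" using False insert by (simp add: card_gt_0_iff)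
    moreover have "b \<notin> A" using insert by auto
    ultimately show ?thesis
      using R z insert \<open>Max A < b\<close> \<open>Min A \<le> Max A\<close>
      by (intro exI[of _ "insert z R"]) force
  qed
qed

text \<open>Each derivative gains one zero by Rolle's theorem: the \<open>k\<close> zeros of the \<open>k\<close>-th derivative in the open
  interval and the two endpoints, where it vanishes as long as \<open>k < n\<close>, leave \<open>k + 1\<close> gaps.\<close>

lemma rodrigues_roots:
  assumes "k \<le> n"
  shows "\<exists>S. finite S \<and> card S = k \<and> S \<subseteq> {-1<..<1} \<and>
     (\<forall>x\<in>S. poly ((pderiv ^^ k) ([:-1, 0, 1::real:] ^ n)) x = 0)"
  using assms
proof (induction k)
  case 0
  then show ?case by (intro exI[of _ "{}"]) auto
next
  case (Suc k)
  then obtain S where S: "finite S" "card S = k" "S \<subseteq> {-1<..<1}"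
     "\<forall>x\<in>S. poly ((pderiv ^^ k) ([:-1, 0, 1::real:] ^ n)) x = 0" by auto
  define T where "T = insert (-1) (insert 1 S)"
  have "finite T" "T \<noteq> {}" using S by (auto simp: T_def)
  moreover have "poly ((pderiv ^^ k) ([:-1, 0, 1::real:] ^ n)) x = 0" if "x \<in> T" for x
    using that S Suc.prems rodrigues_boundary[of k n] by (auto simp: T_def)
  ultimately obtain R where R: "finite R" "card R = card T - 1"
    "\<forall>x\<in>R. Min T < x \<and> x < Max T \<and> poly (pderiv ((pderiv ^^ k) ([:-1, 0, 1::real:] ^ n))) x = 0"
    using Rolle_finite[of T] by blast
  have "1 \<notin> S" "-1 \<notin> S" using S by auto
  then have "card T = Suc (Suc k)" using S by (simp add: T_def)
  moreover have "Min T \<ge> -1" "Max T \<le> 1"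
    using S \<open>finite T\<close> \<open>T \<noteq> {}\<close> by (auto simp: T_def simp del: Min_insert Max_insert Min_insert2 Max_insert2)
  ultimately show ?case using R by (intro exI[of _ R]) force
qed

lemma legendre_degree: "degree (legendre_poly n) = n"
proof -
  have "degree ([:-1, 0, 1::real:] ^ n) = 2 * n"
    by (simp add: degree_power_eq)
  then show ?thesis by (simp add: legendre_poly_def degree_higher_pderiv)
qed

lemma legendre_nonzero: "legendre_poly n \<noteq> 0"
  using legendre_at_1[of n] by auto

section \<open>Nodes, exactness and weights of the Gauss-Legendre rule\<close>

lemma gauss_nodes_finite [simp]: "finite (gauss_nodes n)"
  unfolding gauss_nodes_def by (rule poly_roots_finite[OF legendre_nonzero])

lemma gauss_nodes_card_subset: "card (gauss_nodes n) = n \<and> gauss_nodes n \<subseteq> {-1<..<1}"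
proof -
  obtain S where S: "finite S" "card S = n" "S \<subseteq> {-1<..<1}"
     "\<forall>x\<in>S. poly (legendre_poly n) x = 0"
    using rodrigues_roots[of n n] by (auto simp: legendre_poly_def)
  have sub: "S \<subseteq> gauss_nodes n" using S by (auto simp: gauss_nodes_def)
  have "card (gauss_nodes n) \<le> n"
    using card_poly_roots_bound[OF legendre_nonzero, of n] legendre_degree[of n]
    by (simp add: gauss_nodes_def)
  with sub S have "S = gauss_nodes n"
    by (metis card_subset_eq card_mono gauss_nodes_finite le_antisym)
  with S show ?thesis by auto
qed

lemmas card_gauss_nodes = gauss_nodes_card_subset[THEN conjunct1]
lemmas gauss_nodes_subset = gauss_nodes_card_subset[THEN conjunct2]

lemma gauss_nodes_in: "t \<in> gauss_nodes n \<Longrightarrow> -1 < t \<and> t < 1"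
  using gauss_nodes_subset[of n] by auto

lemma legendre_factorization:
  obtains c where "legendre_poly n = smult c (\<Prod>t\<in>gauss_nodes n. [:-t, 1:])"
proof
  let ?c = "lead_coeff (legendre_poly n)" and ?Q = "\<Prod>t\<in>gauss_nodes n. [:-t, 1:]"
  have deg: "degree ?Q = n"
    by (subst degree_prod_eq_sum_degree) (simp_all add: card_gauss_nodes)
  have "lead_coeff ?Q = 1" by (simp add: lead_coeff_prod)
  then have "coeff ?Q n = 1" using deg by simp
  moreover have "poly ?Q z = 0" if "z \<in> gauss_nodes n" for z
    using that by (auto simp: poly_prod)
  ultimately show "legendre_poly n = smult ?c ?Q"
    using deg legendre_degree[of n] card_gauss_nodes[of n]
    by (intro poly_eqI_degree_lead_coeff[where n = n and A = "gauss_nodes n"])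
       (auto simp: gauss_nodes_def)
qed

lemma log_derivative_prod_linear:
  fixes S :: "real set"
  assumes "finite S" "x \<notin> S" "p = smult c (\<Prod>t\<in>S. [:-t, 1:])"
  shows "poly (pderiv p) x = poly p x * (\<Sum>t\<in>S. 1 / (x - t))"
proof -
  have "(\<Prod>s\<in>S - {t}. x - s) = (\<Prod>s\<in>S. x - s) / (x - t)" if "t \<in> S" for t
    using that assms prod.remove[of S t "\<lambda>s. x - s"] by force
  then show ?thesis
    using assms by (auto simp: pderiv_smult pderiv_prod poly_sum poly_prod pderiv_pCons
        sum_distrib_left sum_distrib_right intro!: sum.cong)
qed

text \<open>At \<open>x = 1\<close> Legendre's equation reads \<open>2 P\<^sub>n'(1) = n (n + 1) P\<^sub>n(1)\<close>, while \<open>P\<^sub>n'(1) / P\<^sub>n(1)\<close> is the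
  sum of \<open>1 / (1 - t)\<close> over all nodes. As all summands are positive, each of them is at most
  \<open>n (n + 1) / 2\<close>. The same argument applies at \<open>-1\<close>.\<close>

lemma gauss_node_endpoint_distance:
  assumes "t \<in> gauss_nodes n"
  shows "1 - \<bar>t\<bar> \<ge> 2 / (real n * (real n + 1))"
proof -
  obtain c where c: "legendre_poly n = smult c (\<Prod>t\<in>gauss_nodes n. [:-t, 1:])"
    by (rule legendre_factorization)
  have n: "n > 0" using assms card_gauss_nodes[of n] by (cases n) auto
  note r = gauss_nodes_in[of _ n]
  have notin: "1 \<notin> gauss_nodes n" "-1 \<notin> gauss_nodes n" using r by force+
  \<comment> \<open>the logarithmic derivative at the endpoint, evaluated by the differential equation\<close>
  have at1: "(\<Sum>t\<in>gauss_nodes n. 1 / (1 - t)) = real n * (real n + 1) / 2"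
    using log_derivative_prod_linear[OF _ notin(1) c] legendre_ode[of 1 n]
    by (simp add: legendre_at_1)
  define L where "L = (\<Sum>t\<in>gauss_nodes n. 1 / (-1 - t))"
  have "- 2 * ((-1) ^ n * L) = real n * (real n + 1) * (-1) ^ n"
    using log_derivative_prod_linear[OF _ notin(2) c] legendre_ode[of "-1" n]
    by (simp add: legendre_at_minus_1 L_def)
  then have "(-1) ^ n * (2 * L + real n * (real n + 1)) = 0" by (simp only: algebra_simps)
  then have "(\<Sum>t\<in>gauss_nodes n. 1 / (-1 - t)) = - real n * (real n + 1) / 2"
    by (simp add: L_def)
  moreover have "(\<Sum>t\<in>gauss_nodes n. 1 / (-1 - t)) = - (\<Sum>t\<in>gauss_nodes n. 1 / (1 + t))"
    unfolding sum_negf[symmetric] by (intro sum.cong) (auto simp: divide_simps)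
  ultimately have at2: "(\<Sum>t\<in>gauss_nodes n. 1 / (1 + t)) = real n * (real n + 1) / 2" by simp
  have "1 / (1 - t) \<le> (\<Sum>t\<in>gauss_nodes n. 1 / (1 - t))"
      "1 / (1 + t) \<le> (\<Sum>t\<in>gauss_nodes n. 1 / (1 + t))"
    using assms r by (intro member_le_sum; force simp: less_imp_le)+
  then have "1 / (1 - t) \<le> real n * (real n + 1) / 2" "1 / (1 + t) \<le> real n * (real n + 1) / 2"
    unfolding at1 at2 by auto
  with r[OF assms] n have "2 / (real n * (real n + 1)) \<le> 1 - t" "2 / (real n * (real n + 1)) \<le> 1 + t"
    by (simp_all add: field_simps)
  then show ?thesis by (simp add: abs_if)
qed

definition lagrange_basis :: "nat \<Rightarrow> real \<Rightarrow> real poly" where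
  "lagrange_basis n t = (\<Prod>u\<in>gauss_nodes n - {t}. smult (1 / (t - u)) [:-u, 1:])"

lemma gauss_weight_poly: "gauss_weight n t = integral {-1..1} (poly (lagrange_basis n t))"
  unfolding gauss_weight_def
  by (rule arg_cong[where f = "integral _"])
     (simp add: fun_eq_iff lagrange_basis_def poly_prod diff_divide_distrib)

lemma lagrange_interpolation:
  assumes "degree r < n"
  shows "r = (\<Sum>t\<in>gauss_nodes n. smult (poly r t) (lagrange_basis n t))"
proof (rule poly_eqI_degree[where A = "gauss_nodes n"])
  have "poly (lagrange_basis n t) x = (if x = t then 1 else 0)"
    if "t \<in> gauss_nodes n" "x \<in> gauss_nodes n" for t x
    using that by (auto simp: lagrange_basis_def poly_prod simp flip: diff_divide_distrib intro!: prod.neutral)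
  then show "poly r x = poly (\<Sum>t\<in>gauss_nodes n. smult (poly r t) (lagrange_basis n t)) x"
    if "x \<in> gauss_nodes n" for x
    using that by (simp add: poly_sum if_distrib[of "\<lambda>z. _ * z"] sum.delta' cong: if_cong)
  show "degree r < card (gauss_nodes n)" using assms by (simp add: card_gauss_nodes)
  have "degree (lagrange_basis n t) < n" if "t \<in> gauss_nodes n" for t
  proof -
    have "degree (lagrange_basis n t) \<le> (\<Sum>u\<in>gauss_nodes n - {t}. degree (smult (1 / (t - u)) [:-u, 1:]))"
      unfolding lagrange_basis_def
      using degree_prod_sum_le[of "gauss_nodes n - {t}" "\<lambda>u. smult (1 / (t - u)) [:-u, 1:]"]
      by (simp only: o_def finite_Diff gauss_nodes_finite)
    also have "\<dots> \<le> (\<Sum>u\<in>gauss_nodes n - {t}. 1)" by (intro sum_mono) simp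
    also have "\<dots> < n" using that assms by (simp add: card_gauss_nodes)
    finally show ?thesis .
  qed
  then show "degree (\<Sum>t\<in>gauss_nodes n. smult (poly r t) (lagrange_basis n t)) < card (gauss_nodes n)"
    using assms unfolding card_gauss_nodes
    by (intro degree_sum_less) (auto intro: le_less_trans[OF degree_smult_le])
qed

lemma integral_poly_sum:
  "finite S \<Longrightarrow> integral {-1..1} (poly (\<Sum>t\<in>S. f t)) = (\<Sum>t\<in>S. integral {-1..1} (poly (f t :: real poly)))"
proof (induction S rule: finite_induct)
  case (insert x F)
  then show ?case by (simp only: sum.insert[OF insert.hyps] integral_poly_add)
qed (simp add: poly_0[abs_def])

text \<open>Division by \<open>P\<^sub>n\<close> leaves a quotient of degree below \<open>n\<close>, whose product with \<open>P\<^sub>n\<close> has integral \<open>0\<close>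
  and vanishes at the nodes, and a remainder that equals its Lagrange interpolation polynomial.\<close>

lemma gauss_exact:
  assumes "degree p < 2 * n"
  shows "gauss_rule n (poly p) = integral {-1..1} (poly p)"
proof -
  let ?P = "legendre_poly n"
  define q where "q = p div ?P"
  define r where "r = p mod ?P"
  have pqr: "p = ?P * q + r" by (simp add: q_def r_def)
  have n: "n > 0" using assms by (cases n) auto
  have r: "degree r < n"
    using degree_mod_less[OF legendre_nonzero, of p n] n by (auto simp: r_def legendre_degree)
  have q: "degree q < n"
  proof (cases "q = 0")
    case False
    then have "degree (?P * q) = n + degree q"
      using legendre_nonzero by (simp add: degree_mult_eq legendre_degree)
    moreover have "degree (?P * q) < 2 * n"
      using pqr degree_diff_less[of p "2 * n" r] assms r n by (simp add: algebra_simps)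
    ultimately show ?thesis by simp
  qed (use n in simp)
  have pr: "poly p t = poly r t" if "t \<in> gauss_nodes n" for t
    using that pqr by (simp add: gauss_nodes_def)
  have "integral {-1..1} (poly p) = integral {-1..1} (poly r)"
    unfolding pqr integral_poly_add legendre_orthogonal[OF q] by simp
  also have "\<dots> = integral {-1..1} (poly (\<Sum>t\<in>gauss_nodes n. smult (poly r t) (lagrange_basis n t)))"
    by (rule arg_cong[OF lagrange_interpolation[OF r], where f = "\<lambda>p. integral {-1..1} (poly p)"])
  also have "\<dots> = (\<Sum>t\<in>gauss_nodes n. poly r t * gauss_weight n t)"
    by (simp only: integral_poly_sum gauss_nodes_finite integral_poly_smult gauss_weight_poly)
  finally show ?thesis
    using pr by (simp add: gauss_rule_def mult.commute)
qed

text \<open>Let \<open>q = P\<^sub>n / (x - t)\<close>. Integration by parts and orthogonality evaluate the integral of \<open>P\<^sub>n' q\<close>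
  to the boundary terms \<open>1/(1 - t) + 1/(1 + t)\<close>. The rule is exact for this polynomial of degree
  \<open>2 n - 2\<close>, and \<open>t\<close> is the only node where it does not vanish, with value \<open>P\<^sub>n'(t)\<^sup>2\<close>.\<close>

lemma gauss_weight_formula:
  assumes t: "t \<in> gauss_nodes n"
  shows "gauss_weight n t * (1 - t\<^sup>2) * (poly (pderiv (legendre_poly n)) t)\<^sup>2 = 2"
proof -
  let ?P = "legendre_poly n"
  have n: "n > 0" using assms card_gauss_nodes[of n] by (cases n) auto
  have "[:-t, 1:] dvd ?P" using t by (simp add: gauss_nodes_def poly_eq_0_iff_dvd)
  then obtain q where q: "?P = [:-t, 1:] * q" by (auto simp: dvd_def)
  then have q0: "q \<noteq> 0" using legendre_nonzero[of n] by auto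
  then have dq: "degree q = n - 1"
    using legendre_degree[of n] by (simp add: q degree_mult_eq del: mult_pCons_left)
  have qt: "poly (pderiv ?P) t = poly q t"
    unfolding q by (simp add: pderiv_mult pderiv_pCons del: mult_pCons_left)
  have tb: "-1 < t" "t < 1" using gauss_nodes_in[OF t] by auto
  have q1: "poly q 1 * (1 - t) = 1" "poly q (-1) * (-1 - t) = (-1) ^ n"
    using legendre_at_1[of n] legendre_at_minus_1[of n] unfolding q by (simp_all add: algebra_simps)
  have "degree (pderiv q) < n" using n by (simp add: degree_pderiv dq)
  then have orth: "integral {-1..1} (poly (?P * pderiv q)) = 0" by (rule legendre_orthogonal)
  have "poly ?P 1 * poly q 1 - poly ?P (-1) * poly q (-1) = 1 / (1 - t) + 1 / (1 + t)"
  proof -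
    have "poly q 1 = 1 / (1 - t)" using q1(1) tb by (simp add: field_simps)
    moreover have "poly q (-1) = - ((-1) ^ n) / (1 + t)" using q1(2) tb by (simp add: field_simps)
    ultimately show ?thesis
      by (simp add: legendre_at_1 legendre_at_minus_1 power_mult_distrib[symmetric])
  qed
  then have int: "integral {-1..1} (poly (pderiv ?P * q)) = 1 / (1 - t) + 1 / (1 + t)"
    using orth by (simp only: integral_by_parts_poly)
  have "degree (pderiv ?P * q) < 2 * n"
    using degree_mult_le[of "pderiv ?P" q] n by (simp add: degree_pderiv legendre_degree dq)
  from gauss_exact[OF this] int have
    "(\<Sum>s\<in>gauss_nodes n. gauss_weight n s * poly (pderiv ?P * q) s) = 1 / (1 - t) + 1 / (1 + t)"
    by (simp add: gauss_rule_def)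
  moreover have "poly q s = 0" if "s \<in> gauss_nodes n" "s \<noteq> t" for s
  proof -
    have "poly ?P s = 0" using that by (simp add: gauss_nodes_def)
    then show ?thesis unfolding q using that by simp
  qed
  then have "(\<Sum>s\<in>gauss_nodes n. gauss_weight n s * poly (pderiv ?P * q) s)
      = (\<Sum>s\<in>gauss_nodes n. if s = t then gauss_weight n t * poly (pderiv ?P * q) t else 0)"
    by (intro sum.cong) auto
  ultimately have "gauss_weight n t * (poly (pderiv ?P) t)\<^sup>2 = 1 / (1 - t) + 1 / (1 + t)"
    using t by (simp add: qt power2_eq_square)
  moreover have "1 / (1 - t) + 1 / (1 + t) = 2 / (1 - t\<^sup>2)"
  proof -
    have "1 - t\<^sup>2 = (1 - t) * (1 + t)" by (simp add: power2_eq_square algebra_simps)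
    with tb show ?thesis by (simp add: add_frac_eq)
  qed
  moreover have "1 - t\<^sup>2 > 0" using tb by (simp add: abs_square_less_1 abs_less_iff)
  ultimately show ?thesis by (simp add: field_simps)
qed

lemma gauss_weight_pos:
  assumes "t \<in> gauss_nodes n"
  shows "gauss_weight n t > 0"
proof -
  have "1 - t\<^sup>2 > 0" using gauss_nodes_in[OF assms] by (simp add: abs_square_less_1 abs_less_iff)
  with gauss_weight_formula[OF assms] show ?thesis
    by (smt (verit) mult_nonpos_nonneg zero_le_power2 mult.assoc mult_nonneg_nonneg)
qed

lemma sum_gauss_weight: "n > 0 \<Longrightarrow> (\<Sum>t\<in>gauss_nodes n. gauss_weight n t) = 2"
  using gauss_exact[of 1 n] by (simp add: gauss_rule_def poly_1[abs_def])

section \<open>Perturbed harmonic oscillators\<close>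

text \<open>The equation \<open>u'' + \<nu> (\<nu> + p) u = 0\<close> as a system for \<open>u\<close> and \<open>r = u' / \<nu>\<close>. The function \<open>g\<close> is the
  antiderivative of \<open>-p\<close> that vanishes at the base point \<open>c\<close>: it measures the accumulated perturbation.\<close>

locale perturbed_oscillator =
  fixes \<nu> a b c :: real and u r p g :: "real \<Rightarrow> real"
  assumes nu: "\<nu> > 0" and acb: "a < c" "c < b"
    and du: "a < x \<Longrightarrow> x < b \<Longrightarrow> (u has_real_derivative \<nu> * r x) (at x)"
    and dr: "a < x \<Longrightarrow> x < b \<Longrightarrow> (r has_real_derivative - (\<nu> + p x) * u x) (at x)"
    and dg: "a < x \<Longrightarrow> x < b \<Longrightarrow> (g has_real_derivative - p x) (at x)"
    and p_nonneg: "a < x \<Longrightarrow> x < b \<Longrightarrow> p x \<ge> 0"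
    and p_cont: "a < x \<Longrightarrow> x < b \<Longrightarrow> isCont p x"
    and g_c: "g c = 0"
    and nontrivial: "u c \<noteq> 0 \<or> r c \<noteq> 0"
begin

text \<open>The squared radius in the phase plane.\<close>

definition "amp x = (u x)\<^sup>2 + (r x)\<^sup>2"

lemma amp_deriv:
  assumes "a < x" "x < b"
  shows "(amp has_real_derivative - 2 * p x * u x * r x) (at x)"
  unfolding amp_def[abs_def]
  by (rule derivative_eq_intros du dr assms refl)+ (simp add: algebra_simps)

lemma amp_c: "amp c > 0"
  using nontrivial by (auto simp: amp_def add_pos_nonneg add_nonneg_pos)

lemma abs_prod_le_amp: "2 * \<bar>u x * r x\<bar> \<le> amp x"
  using sum_squares_bound[of "\<bar>u x\<bar>" "\<bar>r x\<bar>"] by (simp add: amp_def abs_mult)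

lemma amp_exp_deriv:
  assumes "a < x" "x < b"
  shows "((\<lambda>x. amp x * exp (s * g x)) has_real_derivative
     (- 2 * p x * u x * r x - s * p x * amp x) * exp (s * g x)) (at x)"
  by (rule derivative_eq_intros amp_deriv dg assms refl)+ (simp add: algebra_simps)

text \<open>The logarithmic derivative of the amplitude lies between \<open>-p\<close> and \<open>p\<close>, so that the factors \<open>exp g\<close>
  and \<open>exp (- g)\<close> turn it into a monotone function.\<close>

lemma amp_exp_decreasing:
  assumes "a < x" "x \<le> y" "y < b"
  shows "amp y * exp (g y) \<le> amp x * exp (g x)"
proof (rule DERIV_nonpos_imp_nonincreasing[OF \<open>x \<le> y\<close>])
  fix z assume z: "x \<le> z" "z \<le> y"
  have "p z * (2 * (- (u z * r z))) \<le> p z * amp z"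
    using p_nonneg[of z] abs_prod_le_amp[of z] z assms by (intro mult_left_mono) auto
  then show "\<exists>D. ((\<lambda>x. amp x * exp (g x)) has_real_derivative D) (at z) \<and> D \<le> 0"
    using amp_exp_deriv[of z 1] z assms
    by (intro exI[of _ "(- 2 * p z * u z * r z - p z * amp z) * exp (g z)"])
       (auto intro!: mult_nonpos_nonneg simp: mult.assoc)
qed

lemma amp_exp_increasing:
  assumes "a < x" "x \<le> y" "y < b"
  shows "amp x * exp (- g x) \<le> amp y * exp (- g y)"
proof (rule DERIV_nonneg_imp_nondecreasing[OF \<open>x \<le> y\<close>])
  fix z assume z: "x \<le> z" "z \<le> y"
  have "p z * (2 * (u z * r z)) \<le> p z * amp z"
    using p_nonneg[of z] abs_prod_le_amp[of z] z assms by (intro mult_left_mono) auto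
  then show "\<exists>D. ((\<lambda>x. amp x * exp (- g x)) has_real_derivative D) (at z) \<and> 0 \<le> D"
    using amp_exp_deriv[of z "-1"] z assms
    by (intro exI[of _ "(- 2 * p z * u z * r z + p z * amp z) * exp (- g z)"])
       (auto intro!: mult_nonneg_nonneg simp: mult.assoc)
qed

lemma g_sign:
  shows "a < x \<Longrightarrow> x \<le> c \<Longrightarrow> g x \<ge> 0" and "c \<le> x \<Longrightarrow> x < b \<Longrightarrow> g x \<le> 0"
proof -
  have "g y \<le> g x" if "a < x" "x \<le> y" "y < b" for x y
    using that dg p_nonneg
    by (intro DERIV_nonpos_imp_nonincreasing[OF \<open>x \<le> y\<close>]) (meson le_less_trans less_le_trans neg_le_0_iff_le)
  from this[of x c] this[of c x] acb
  show "a < x \<Longrightarrow> x \<le> c \<Longrightarrow> g x \<ge> 0" and "c \<le> x \<Longrightarrow> x < b \<Longrightarrow> g x \<le> 0"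
    by (auto simp: g_c)
qed

lemma amp_bounds:
  assumes "a < x" "x < b"
  shows "amp c * exp (- \<bar>g x\<bar>) \<le> amp x" "amp x \<le> amp c * exp \<bar>g x\<bar>"
proof -
  have "amp c * exp (- \<bar>g x\<bar>) \<le> amp x \<and> amp x \<le> amp c * exp \<bar>g x\<bar>"
  proof (cases "x \<le> c")
    case True
    with amp_exp_decreasing[of x c] amp_exp_increasing[of x c] g_sign(1)[of x] assms acb
    show ?thesis by (simp add: g_c exp_minus field_simps)
  next
    case False
    with amp_exp_decreasing[of c x] amp_exp_increasing[of c x] g_sign(2)[of x] assms acb
    show ?thesis by (simp add: g_c exp_minus field_simps)
  qed
  then show "amp c * exp (- \<bar>g x\<bar>) \<le> amp x" "amp x \<le> amp c * exp \<bar>g x\<bar>" by auto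
qed

lemma amp_pos: "a < x \<Longrightarrow> x < b \<Longrightarrow> amp x > 0"
  using amp_bounds(1)[of x] amp_c by (smt (verit) exp_gt_zero mult_pos_pos)

text \<open>In polar coordinates \<open>u = R cos \<psi>\<close>, \<open>r = - R sin \<psi>\<close> the angle \<open>\<psi>\<close> advances at the rate \<open>\<nu> + p u\<^sup>2 / (u\<^sup>2 + r\<^sup>2)\<close>. The function \<open>\<eta>\<close>
  is the part of the angle that is due to the perturbation.\<close>

lemma phase_shift_exists:
  obtains \<eta> where "\<eta> c = 0"
    "\<And>x. a < x \<Longrightarrow> x < b \<Longrightarrow> (\<eta> has_real_derivative p x * (u x)\<^sup>2 / amp x) (at x)"
proof -
  have "isCont (\<lambda>x. p x * (u x)\<^sup>2 / amp x) x" if "a < x" "x < b" for x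
    using that amp_pos[of x]
    by (intro continuous_intros p_cont DERIV_isCont[OF du] DERIV_isCont[OF amp_deriv]) auto
  with einterval_antiderivative[of "ereal a" "ereal b" "\<lambda>x. p x * (u x)\<^sup>2 / amp x"] acb
  obtain F where F: "\<And>x. a < x \<Longrightarrow> x < b \<Longrightarrow> (F has_real_derivative p x * (u x)\<^sup>2 / amp x) (at x)"
    by (auto simp: has_real_derivative_iff_has_vector_derivative)
  show thesis
    by (rule that[of "\<lambda>x. F x - F c"]) (auto intro!: derivative_eq_intros F)
qed

text \<open>A continuous polar angle is obtained without inverse trigonometric functions: the angle \<open>\<psi>\<close> is
  defined by its rate of change, and \<open>h = u sin \<psi> + r cos \<psi>\<close> then satisfies the same linear equation
  as \<open>sqrt (amp)\<close>. Hence \<open>h\<^sup>2 / amp\<close> is constant, and it vanishes at \<open>c\<close>.\<close>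

lemma pruefer_phase:
  assumes start: "u c * sin \<alpha> + r c * cos \<alpha> = 0"
  obtains \<psi> where
    "\<And>x. a < x \<Longrightarrow> x < b \<Longrightarrow> u x * sin (\<psi> x) + r x * cos (\<psi> x) = 0"
    "\<And>x. a < x \<Longrightarrow> x < b \<Longrightarrow> \<bar>\<psi> x - (\<nu> * (x - c) + \<alpha>)\<bar> \<le> \<bar>g x\<bar>"
    "\<And>x y. a < x \<Longrightarrow> x < y \<Longrightarrow> y < b \<Longrightarrow> \<psi> x < \<psi> y"
proof -
  obtain \<eta> where eta_c: "\<eta> c = 0" and
    deta: "\<And>x. a < x \<Longrightarrow> x < b \<Longrightarrow> (\<eta> has_real_derivative p x * (u x)\<^sup>2 / amp x) (at x)"
    using phase_shift_exists by blast
  define \<psi> where "\<psi> x = \<nu> * (x - c) + \<alpha> + \<eta> x" for x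
  have range: "0 \<le> p x * (u x)\<^sup>2 / amp x" "p x * (u x)\<^sup>2 / amp x \<le> p x" if "a < x" "x < b" for x
  proof -
    have "(u x)\<^sup>2 \<le> amp x" by (simp add: amp_def)
    then have "(u x)\<^sup>2 / amp x \<le> 1" using amp_pos[OF that] by simp
    from mult_left_mono[OF this p_nonneg[OF that]] show "p x * (u x)\<^sup>2 / amp x \<le> p x" by simp
    show "0 \<le> p x * (u x)\<^sup>2 / amp x" using amp_pos[OF that] p_nonneg[OF that] by simp
  qed
  have eta_mono: "\<eta> x \<le> \<eta> y" if "a < x" "x \<le> y" "y < b" for x y
    using that deta range(1)
    by (intro DERIV_nonneg_imp_nondecreasing[OF \<open>x \<le> y\<close>]) (meson le_less_trans less_le_trans)
  have eta_g: "\<eta> y + g y \<le> \<eta> x + g x" if "a < x" "x \<le> y" "y < b" for x y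
  proof (rule DERIV_nonpos_imp_nonincreasing[OF \<open>x \<le> y\<close>])
    fix z assume "x \<le> z" "z \<le> y"
    then have z: "a < z" "z < b" using that by auto
    from DERIV_add[OF deta[OF z] dg[OF z]] range(2)[OF z]
    show "\<exists>D. ((\<lambda>x. \<eta> x + g x) has_real_derivative D) (at z) \<and> D \<le> 0" by force
  qed
  have dpsi: "(\<psi> has_real_derivative \<nu> + p x * (u x)\<^sup>2 / amp x) (at x)" if "a < x" "x < b" for x
    unfolding \<psi>_def[abs_def] by (rule derivative_eq_intros deta that refl)+ simp
  \<comment> \<open>vanishes exactly if \<open>(u, r)\<close> is a multiple of \<open>(cos \<psi>, - sin \<psi>)\<close>\<close>
  define h where "h x = u x * sin (\<psi> x) + r x * cos (\<psi> x)" for x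
  have dh: "(h has_real_derivative - (p x * u x * r x / amp x) * h x) (at x)" if x: "a < x" "x < b" for x
  proof -
    \<comment> \<open>The inverse amplitude gets a name, so that the derivative becomes polynomial in \<open>k\<close>.\<close>
    define k where "k = 1 / amp x"
    have k: "k * ((u x)\<^sup>2 + (r x)\<^sup>2) = 1" using amp_pos[OF x] by (simp add: k_def flip: amp_def)
    have "(h has_real_derivative
        \<nu> * r x * sin (\<psi> x) + u x * ((\<nu> + p x * (u x)\<^sup>2 * k) * cos (\<psi> x))
        + (- (\<nu> + p x) * u x * cos (\<psi> x) - r x * ((\<nu> + p x * (u x)\<^sup>2 * k) * sin (\<psi> x)))) (at x)"
      unfolding h_def[abs_def]
      by (rule derivative_eq_intros du dr dpsi x refl)+ (simp add: k_def algebra_simps)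
    moreover have "\<nu> * r x * sin (\<psi> x) + u x * ((\<nu> + p x * (u x)\<^sup>2 * k) * cos (\<psi> x))
        + (- (\<nu> + p x) * u x * cos (\<psi> x) - r x * ((\<nu> + p x * (u x)\<^sup>2 * k) * sin (\<psi> x)))
        = - (p x * u x * r x * k) * h x + p x * u x * cos (\<psi> x) * (k * ((u x)\<^sup>2 + (r x)\<^sup>2) - 1)"
      by (simp add: h_def algebra_simps power2_eq_square)
    ultimately have "(h has_real_derivative - (p x * u x * r x * k) * h x) (at x)"
      by (simp only: k diff_self mult_zero_right add_0_right)
    then show ?thesis by (simp add: k_def)
  qed
  have dquot: "((\<lambda>x. (h x)\<^sup>2 / amp x) has_real_derivative 0) (at x)" if x: "a < x" "x < b" for x
  proof -
    have "((\<lambda>x. h x * h x / amp x) has_real_derivative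
      ((- (p x * u x * r x / amp x) * h x * h x + - (p x * u x * r x / amp x) * h x * h x) * amp x
        - h x * h x * (- 2 * p x * u x * r x)) / (amp x * amp x)) (at x)"
      using amp_pos[OF x] by (intro DERIV_divide DERIV_mult dh amp_deriv x) simp
    moreover have "(- (p x * u x * r x / amp x) * h x * h x + - (p x * u x * r x / amp x) * h x * h x) * amp x
        - h x * h x * (- 2 * p x * u x * r x) = 0"
      using amp_pos[OF x] by (simp add: algebra_simps)
    ultimately show ?thesis by (simp add: power2_eq_square)
  qed
  have "h x = 0" if x: "a < x" "x < b" for x
  proof -
    have "(h x)\<^sup>2 / amp x = (h c)\<^sup>2 / amp c"
      using dquot x acb
      by (intro DERIV_isconst3[of a b x c "\<lambda>x. (h x)\<^sup>2 / amp x"]) auto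
    moreover have "h c = 0" using start by (simp add: h_def \<psi>_def eta_c)
    ultimately show ?thesis using amp_pos[OF x] by simp
  qed
  moreover have "\<bar>\<eta> x\<bar> \<le> \<bar>g x\<bar>" if x: "a < x" "x < b" for x
    using eta_mono[of x c] eta_mono[of c x] eta_g[of x c] eta_g[of c x] x acb
    by (cases "x \<le> c") (auto simp: eta_c g_c)
  moreover have "\<psi> x < \<psi> y" if "a < x" "x < y" "y < b" for x y
    using eta_mono[of x y] that nu by (simp add: \<psi>_def add_less_le_mono)
  ultimately show thesis
    by (intro that[of \<psi>]) (auto simp: h_def \<psi>_def eta_c)
qed

end

section \<open>Position of the nodes and size of the weights\<close>

text \<open>The first bound makes the perturbation of the phase, which is at most \<open>1 / (4 \<nu> sin \<theta>)\<close>, at most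
  \<open>1/4\<close> at every node. The next two then keep the phase inside the range \<open>(0, n \<pi>)\<close> that contains
  exactly \<open>n\<close> zeros of the cosine.\<close>

lemma gauss_node_angle:
  assumes "t \<in> gauss_nodes n"
  shows "sin (arccos t) \<ge> 1 / (real n + 1/2)"
    and "arccos t \<ge> 2 / (real n + 1/2)" and "pi - arccos t \<ge> 2 / (real n + 1/2)"
    and "0 < arccos t" and "arccos t < pi" and "cos (arccos t) = t"
proof -
  let ?\<theta> = "arccos t" and ?\<nu> = "real n + 1/2"
  have t: "-1 < t" "t < 1" using gauss_nodes_in[OF assms] by auto
  then show th: "0 < ?\<theta>" "?\<theta> < pi" "cos ?\<theta> = t"
    using arccos_lt_bounded[of t] by simp_all
  have n: "n > 0" using assms card_gauss_nodes[of n] by (cases n) auto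
  have "real n * (real n + 1) \<le> ?\<nu>\<^sup>2" by (simp add: power2_eq_square algebra_simps)
  then have "2 / ?\<nu>\<^sup>2 \<le> 2 / (real n * (real n + 1))"
    using n by (intro divide_left_mono mult_pos_pos zero_less_power) simp_all
  with gauss_node_endpoint_distance[OF assms] have d: "2 / ?\<nu>\<^sup>2 \<le> 1 - \<bar>t\<bar>" by simp
  have small: "2 / ?\<nu> \<le> x" if "x \<ge> 0" "2 / ?\<nu>\<^sup>2 \<le> 1 - cos x" for x
  proof -
    have "(sin (x / 2))\<^sup>2 \<le> (x / 2)\<^sup>2"
      using abs_sin_x_le_abs_x[of "x / 2"] by (simp only: abs_le_square_iff)
    then have "1 - cos x \<le> x\<^sup>2 / 2"
      using cos_double_sin[of "x / 2"] by (simp add: power_divide)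
    moreover have "(2 / ?\<nu>)\<^sup>2 = 2 * (2 / ?\<nu>\<^sup>2)" by (simp add: power_divide)
    ultimately have "(2 / ?\<nu>)\<^sup>2 \<le> x\<^sup>2" using that by linarith
    then show ?thesis using \<open>x \<ge> 0\<close> by (rule power2_le_imp_le)
  qed
  show "2 / ?\<nu> \<le> ?\<theta>" using small[of ?\<theta>] d th by simp
  show "2 / ?\<nu> \<le> pi - ?\<theta>" using small[of "pi - ?\<theta>"] d th by (simp add: cos_pi_minus)
  have "(1 / ?\<nu>)\<^sup>2 \<le> 2 / ?\<nu>\<^sup>2" unfolding power_divide by (rule divide_right_mono) simp_all
  also have "\<dots> \<le> 1 - \<bar>t\<bar>" by (rule d)
  also have "\<dots> \<le> 1 - t\<^sup>2"
  proof -
    have "\<bar>t\<bar> * \<bar>t\<bar> \<le> \<bar>t\<bar> * 1" using t by (intro mult_left_mono) auto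
    then show ?thesis by (simp add: power2_eq_square)
  qed
  also have "\<dots> = (sin ?\<theta>)\<^sup>2" using th by (simp add: sin_squared_eq)
  finally show "1 / ?\<nu> \<le> sin ?\<theta>"
    by (rule power2_le_imp_le) (use th sin_gt_zero[of ?\<theta>] in simp)
qed

text \<open>The factor \<open>sqrt (sin x)\<close> is Liouville's substitution, which removes the first-order term from
  Legendre's equation in the variable \<open>x = arccos t\<close>. The second function is the derivative of the
  first one, divided by \<open>n + 1/2\<close>.\<close>

definition "liouville_u n x = sqrt (sin x) * poly (legendre_poly n) (cos x)"
definition "liouville_r n x = sqrt (sin x) * (cos x / (2 * sin x) * poly (legendre_poly n) (cos x)
   - sin x * poly (pderiv (legendre_poly n)) (cos x)) / (real n + 1/2)"

lemma liouville_oscillator: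
  "perturbed_oscillator (real n + 1/2) 0 pi (pi/2) (liouville_u n) (liouville_r n)
     (\<lambda>x. 1 / (4 * (real n + 1/2) * (sin x)\<^sup>2)) (\<lambda>x. cos x / (4 * (real n + 1/2) * sin x))"
proof
  let ?P = "legendre_poly n" and ?\<nu> = "real n + 1/2"
  show "?\<nu> > 0" "0 < pi / 2" "pi / 2 < pi" "cos (pi/2) / (4 * ?\<nu> * sin (pi/2)) = 0" by auto
  fix x :: real assume x: "0 < x" "x < pi"
  have s: "sin x > 0" using x by (rule sin_gt_zero)
  have ds: "((\<lambda>x. sqrt (sin x)) has_real_derivative sqrt (sin x) * (cos x / (2 * sin x))) (at x)"
    using s by (auto intro!: derivative_eq_intros simp: field_simps)
  have dP: "((\<lambda>x. poly q (cos x)) has_real_derivative poly (pderiv q) (cos x) * - sin x) (at x)" for q :: "real poly"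
    by (intro DERIV_chain2[where g = cos] poly_DERIV) simp
  have nur: "?\<nu> * liouville_r n x = sqrt (sin x) * (cos x / (2 * sin x) * poly ?P (cos x)
      - sin x * poly (pderiv ?P) (cos x))" by (simp add: liouville_r_def)
  show "(liouville_u n has_real_derivative ?\<nu> * liouville_r n x) (at x)"
    unfolding liouville_u_def[abs_def] nur
    by (rule DERIV_cong[OF DERIV_mult[OF ds dP[of ?P]]]) (simp add: algebra_simps)
  have cot: "((\<lambda>x. cos x / sin x) has_real_derivative - 1 / (sin x)\<^sup>2) (at x)"
  proof -
    have "((\<lambda>x. cos x / sin x) has_real_derivative
        (- sin x * sin x - cos x * cos x) / (sin x * sin x)) (at x)"
      using s by (auto intro!: derivative_eq_intros)
    moreover have "- sin x * sin x - cos x * cos x = -1"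
      using sin_cos_squared_add[of x] by (simp add: power2_eq_square)
    ultimately show ?thesis by (simp add: power2_eq_square)
  qed
  from DERIV_cmult[OF this, of "1 / (4 * ?\<nu>)"]
  show "((\<lambda>x. cos x / (4 * ?\<nu> * sin x)) has_real_derivative - (1 / (4 * ?\<nu> * (sin x)\<^sup>2))) (at x)"
    by (simp add: mult.assoc)
  \<comment> \<open>the derivative of \<open>u\<close> without the factor \<open>sqrt (sin x)\<close>\<close>
  define W where "W x = cos x / sin x * (1/2 * poly ?P (cos x)) - sin x * poly (pderiv ?P) (cos x)" for x
  have r_eq: "liouville_r n = (\<lambda>x. sqrt (sin x) * W x / ?\<nu>)"
    by (simp add: fun_eq_iff liouville_r_def W_def)
  let ?p = "poly ?P (cos x)" and ?p1 = "poly (pderiv ?P) (cos x)" and ?p2 = "poly (pderiv (pderiv ?P)) (cos x)"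
  have "(W has_real_derivative
      (- 1 / (sin x)\<^sup>2 * (1/2 * ?p) + (1/2 * (?p1 * - sin x)) * (cos x / sin x))
      - (cos x * ?p1 + (?p2 * - sin x) * sin x)) (at x)"
    unfolding W_def[abs_def]
    by (intro DERIV_diff DERIV_mult cot DERIV_cmult dP DERIV_sin)
  from DERIV_cmult[OF DERIV_mult[OF ds this], of "1 / ?\<nu>"]
  have "(liouville_r n has_real_derivative 1 / ?\<nu> * (sqrt (sin x) * (cos x / (2 * sin x)) * W x
      + ((- 1 / (sin x)\<^sup>2 * (1/2 * ?p) + (1/2 * (?p1 * - sin x)) * (cos x / sin x))
      - (cos x * ?p1 + (?p2 * - sin x) * sin x)) * sqrt (sin x))) (at x)"
    by (simp add: r_eq)
  moreover have "1 / ?\<nu> * (sqrt (sin x) * (cos x / (2 * sin x)) * W x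
      + ((- 1 / (sin x)\<^sup>2 * (1/2 * ?p) + (1/2 * (?p1 * - sin x)) * (cos x / sin x))
      - (cos x * ?p1 + (?p2 * - sin x) * sin x)) * sqrt (sin x))
    = sqrt (sin x) / ?\<nu> * ((cos x / (2 * sin x)) * W x
      + (- 1 / (sin x)\<^sup>2 * (1/2 * ?p) + (1/2 * (?p1 * - sin x)) * (cos x / sin x))
      - (cos x * ?p1 + (?p2 * - sin x) * sin x))"
    by (simp add: algebra_simps)
  moreover have "(cos x / (2 * sin x)) * W x
      + (- 1 / (sin x)\<^sup>2 * (1/2 * ?p) + (1/2 * (?p1 * - sin x)) * (cos x / sin x))
      - (cos x * ?p1 + (?p2 * - sin x) * sin x) = - (?\<nu>\<^sup>2 + 1 / (4 * (sin x)\<^sup>2)) * ?p"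
  proof -
    have c2: "(cos x)\<^sup>2 = 1 - (sin x)\<^sup>2" by (simp add: cos_squared_eq)
    have "(cos x / (2 * sin x)) * W x
      + (- 1 / (sin x)\<^sup>2 * (1/2 * ?p) + (1/2 * (?p1 * - sin x)) * (cos x / sin x))
      - (cos x * ?p1 + (?p2 * - sin x) * sin x)
      = ((cos x)\<^sup>2 / (4 * (sin x)\<^sup>2) - 1 / (2 * (sin x)\<^sup>2)) * ?p
        + ((sin x)\<^sup>2 * ?p2 - 2 * cos x * ?p1)"
      using s by (simp add: W_def field_simps power2_eq_square)
    also have "(sin x)\<^sup>2 * ?p2 - 2 * cos x * ?p1 = - (real n * (real n + 1)) * ?p"
      using legendre_ode[of "cos x" n] by (simp add: c2 algebra_simps)
    also have "(cos x)\<^sup>2 / (4 * (sin x)\<^sup>2) - 1 / (2 * (sin x)\<^sup>2) = - 1/4 - 1 / (4 * (sin x)\<^sup>2)"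
      using s by (simp add: c2 field_simps)
    finally show ?thesis by (simp add: algebra_simps power2_eq_square)
  qed
  ultimately have "(liouville_r n has_real_derivative
      sqrt (sin x) / ?\<nu> * (- (?\<nu>\<^sup>2 + 1 / (4 * (sin x)\<^sup>2)) * ?p)) (at x)" by simp
  moreover have "Q / N * (- (N\<^sup>2 + 1 / (4 * S)) * P) = - (N + 1 / (4 * N * S)) * (Q * P)"
    if "N > 0" "S > 0" for N S P Q :: real
    using that by (simp add: field_simps power2_eq_square)
  from this[of ?\<nu> "(sin x)\<^sup>2" "sqrt (sin x)" ?p] s
  have "sqrt (sin x) / ?\<nu> * (- (?\<nu>\<^sup>2 + 1 / (4 * (sin x)\<^sup>2)) * ?p)
      = - (?\<nu> + 1 / (4 * ?\<nu> * (sin x)\<^sup>2)) * liouville_u n x"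
    by (simp only: liouville_u_def) simp
  ultimately show "(liouville_r n has_real_derivative - (?\<nu> + 1 / (4 * ?\<nu> * (sin x)\<^sup>2)) * liouville_u n x) (at x)"
    by simp
  show "0 \<le> 1 / (4 * ?\<nu> * (sin x)\<^sup>2)" by simp
  show "isCont (\<lambda>x. 1 / (4 * ?\<nu> * (sin x)\<^sup>2)) x"
    using s by (intro continuous_intros) auto
next
  show "liouville_u n (pi/2) \<noteq> 0 \<or> liouville_r n (pi/2) \<noteq> 0"
    using gauss_weight_formula[of 0 n]
    by (auto simp: liouville_u_def liouville_r_def gauss_nodes_def)
qed

lemma legendre_parity_at_0:
  shows "odd n \<Longrightarrow> poly (legendre_poly n) 0 = 0"
    and "even n \<Longrightarrow> poly (pderiv (legendre_poly n)) 0 = 0"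
proof -
  show "odd n \<Longrightarrow> poly (legendre_poly n) 0 = 0"
    using legendre_reflect[of n 0] by simp
  assume "even n"
  then have "poly (legendre_poly n) (-x) = poly (legendre_poly n) x" for x
    using legendre_reflect[of n x] by simp
  then have "pcompose (legendre_poly n) [:0, -1:] = legendre_poly n"
    by (simp flip: poly_eq_poly_eq_iff add: fun_eq_iff poly_pcompose)
  from arg_cong[OF this, where f = "\<lambda>p. poly (pderiv p) 0"]
  show "poly (pderiv (legendre_poly n)) 0 = 0"
    by (simp add: pderiv_pcompose poly_pcompose pderiv_pCons)
qed

text \<open>By parity one of \<open>P\<^sub>n(0)\<close> and \<open>P\<^sub>n'(0)\<close> vanishes, which determines the phase at the midpoint.\<close>

lemma liouville_initial_phase:
  "liouville_u n (pi/2) * sin (real n * (pi/2)) + liouville_r n (pi/2) * cos (real n * (pi/2)) = 0"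
proof (cases "even n")
  case True
  then obtain m where "n = 2 * m" by auto
  then have "sin (real n * (pi/2)) = 0" by simp
  with True show ?thesis
    by (simp add: liouville_u_def liouville_r_def legendre_parity_at_0)
next
  case False
  then obtain m where "n = 2 * m + 1" using oddE by blast
  then have "cos (real n * (pi/2)) = 0" by (simp add: algebra_simps cos_add)
  with False show ?thesis
    by (simp add: liouville_u_def liouville_r_def legendre_parity_at_0)
qed

lemma abs_scaled_cot_le:
  assumes "0 < \<nu>" "0 < sin (x::real)"
  shows "\<bar>cos x / (4 * \<nu> * sin x)\<bar> \<le> 1 / (4 * \<nu> * sin x)"
  using assms by (auto simp: abs_mult intro!: divide_right_mono)

text \<open>The reference phase \<open>\<nu> (x - \<pi>/2) + n \<pi>/2\<close> is \<open>\<nu> x - \<pi>/4\<close>, and at a zero of \<open>u\<close> the cosine of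
  the phase vanishes, because \<open>r\<close> is nonzero there.\<close>

lemma gauss_nodes_phase:
  obtains \<psi> :: "real \<Rightarrow> real" where
    "\<And>x y. 0 < x \<Longrightarrow> x < y \<Longrightarrow> y < pi \<Longrightarrow> \<psi> x < \<psi> y"
    "\<And>x. 0 < x \<Longrightarrow> x < pi \<Longrightarrow> \<bar>\<psi> x - ((real n + 1/2) * x - pi/4)\<bar> \<le> 1 / (4 * (real n + 1/2) * sin x)"
    "\<And>t. t \<in> gauss_nodes n \<Longrightarrow> cos (\<psi> (arccos t)) = 0"
proof -
  let ?\<nu> = "real n + 1/2"
  interpret perturbed_oscillator ?\<nu> 0 pi "pi/2" "liouville_u n" "liouville_r n"
     "\<lambda>x. 1 / (4 * ?\<nu> * (sin x)\<^sup>2)" "\<lambda>x. cos x / (4 * ?\<nu> * sin x)"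
    by (rule liouville_oscillator)
  obtain \<psi> where psi:
    "\<And>x. 0 < x \<Longrightarrow> x < pi \<Longrightarrow> liouville_u n x * sin (\<psi> x) + liouville_r n x * cos (\<psi> x) = 0"
    "\<And>x. 0 < x \<Longrightarrow> x < pi \<Longrightarrow> \<bar>\<psi> x - (?\<nu> * (x - pi/2) + real n * (pi/2))\<bar> \<le> \<bar>cos x / (4 * ?\<nu> * sin x)\<bar>"
    "\<And>x y. 0 < x \<Longrightarrow> x < y \<Longrightarrow> y < pi \<Longrightarrow> \<psi> x < \<psi> y"
    using pruefer_phase[OF liouville_initial_phase] by blast
  show thesis
  proof (rule that[of \<psi>])
    fix x :: real assume x: "0 < x" "x < pi"
    have "?\<nu> * (x - pi/2) + real n * (pi/2) = ?\<nu> * x - pi/4" by (simp add: field_simps)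
    moreover have "\<bar>cos x / (4 * ?\<nu> * sin x)\<bar> \<le> 1 / (4 * ?\<nu> * sin x)"
      by (rule abs_scaled_cot_le[OF _ sin_gt_zero[OF x]]) simp
    ultimately show "\<bar>\<psi> x - (?\<nu> * x - pi/4)\<bar> \<le> 1 / (4 * ?\<nu> * sin x)"
      using psi(2)[OF x] by simp
  next
    fix t assume t: "t \<in> gauss_nodes n"
    note th = gauss_node_angle[OF t]
    have "liouville_u n (arccos t) = 0"
      using t th by (simp add: liouville_u_def gauss_nodes_def)
    moreover from this have "liouville_r n (arccos t) \<noteq> 0"
      using amp_pos[of "arccos t"] th by (auto simp: amp_def)
    ultimately show "cos (\<psi> (arccos t)) = 0"
      using psi(1)[of "arccos t"] th by simp
  qed (use psi in auto)
qed

text \<open>At a node \<open>u = 0\<close>, so the amplitude is \<open>r\<^sup>2 = sin\<^sup>3 \<theta> P\<^sub>n'(t)\<^sup>2 / \<nu>\<^sup>2\<close> and the weight is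
  \<open>2 sin \<theta> / (\<nu>\<^sup>2 amp)\<close>. The constant \<open>\<kappa>\<close> is the value of \<open>2 / (\<nu>\<^sup>2 amp)\<close> at the midpoint.\<close>

lemma gauss_weight_shape:
  obtains \<kappa> where "\<kappa> > 0"
    "\<And>t. t \<in> gauss_nodes n \<Longrightarrow> gauss_weight n t \<le> \<kappa> * sin (arccos t) * exp (1 / (4 * (real n + 1/2) * sin (arccos t)))"
    "\<And>t. t \<in> gauss_nodes n \<Longrightarrow> \<kappa> * sin (arccos t) * exp (- (1 / (4 * (real n + 1/2) * sin (arccos t)))) \<le> gauss_weight n t"
proof -
  let ?\<nu> = "real n + 1/2"
  interpret perturbed_oscillator ?\<nu> 0 pi "pi/2" "liouville_u n" "liouville_r n"
     "\<lambda>x. 1 / (4 * ?\<nu> * (sin x)\<^sup>2)" "\<lambda>x. cos x / (4 * ?\<nu> * sin x)"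
    by (rule liouville_oscillator)
  define \<kappa> where "\<kappa> = 2 / (?\<nu>\<^sup>2 * amp (pi/2))"
  have kap: "\<kappa> > 0" using amp_c by (simp add: \<kappa>_def)
  have w: "gauss_weight n t = \<kappa> * sin (arccos t) * (amp (pi/2) / amp (arccos t))"
    if t: "t \<in> gauss_nodes n" for t
  proof -
    note th = gauss_node_angle[OF t]
    let ?s = "sin (arccos t)" and ?D = "poly (pderiv (legendre_poly n)) t"
    have s: "?s > 0" using th(4,5) by (rule sin_gt_zero)
    have P: "poly (legendre_poly n) t = 0" using t by (simp add: gauss_nodes_def)
    have "amp (arccos t) = ?s ^ 3 * ?D\<^sup>2 / ?\<nu>\<^sup>2"
      using s th P by (simp add: amp_def liouville_u_def liouville_r_def power_divide power_mult_distrib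
          power2_eq_square power3_eq_cube algebra_simps)
    moreover have "1 - t\<^sup>2 = ?s\<^sup>2" using th by (simp add: sin_squared_eq)
    with gauss_weight_formula[OF t] have "gauss_weight n t * ?s\<^sup>2 * ?D\<^sup>2 = 2" by simp
    moreover from this have "?D \<noteq> 0" by auto
    ultimately have "amp (arccos t) = ?s ^ 3 * ?D\<^sup>2 / ?\<nu>\<^sup>2" "gauss_weight n t = 2 / (?s\<^sup>2 * ?D\<^sup>2)"
      using s by (auto simp: field_simps)
    \<comment> \<open>The identity is stated for variables, so that \<open>\<nu> = n + 1/2\<close> is not multiplied out.\<close>
    moreover have "2 / (S\<^sup>2 * D\<^sup>2) = 2 / (N\<^sup>2 * A) * S * (A / (S ^ 3 * D\<^sup>2 / N\<^sup>2))"
      if "S > 0" "N > 0" "A > 0" "D \<noteq> 0" for S N A D :: real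
      using that by (simp add: field_simps power2_eq_square power3_eq_cube)
    from this[of ?s ?\<nu> "amp (pi/2)" ?D] amp_c s \<open>?D \<noteq> 0\<close>
    have "2 / (?s\<^sup>2 * ?D\<^sup>2) = \<kappa> * ?s * (amp (pi/2) / (?s ^ 3 * ?D\<^sup>2 / ?\<nu>\<^sup>2))"
      unfolding \<kappa>_def by simp
    ultimately show ?thesis by simp
  qed
  have ratio: "amp (pi/2) / amp (arccos t) \<le> exp (1 / (4 * ?\<nu> * sin (arccos t)))"
    "exp (- (1 / (4 * ?\<nu> * sin (arccos t)))) \<le> amp (pi/2) / amp (arccos t)"
    if t: "t \<in> gauss_nodes n" for t
  proof -
    note th = gauss_node_angle[OF t]
    let ?g = "\<bar>cos (arccos t) / (4 * ?\<nu> * sin (arccos t))\<bar>" and ?e = "1 / (4 * ?\<nu> * sin (arccos t))"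
    have "?g \<le> ?e"
      by (rule abs_scaled_cot_le[OF _ sin_gt_zero[OF th(4,5)]]) simp
    then have e: "exp ?g \<le> exp ?e" "exp (- ?e) \<le> exp (- ?g)" by simp_all
    note b = amp_bounds[OF th(4,5)] note pos = amp_pos[OF th(4,5)]
    have "amp (pi/2) / amp (arccos t) \<le> exp ?g"
    proof -
      have "amp (pi/2) = amp (pi/2) * exp (- ?g) * exp ?g" by (simp only: mult.assoc exp_add[symmetric]) simp
      also have "\<dots> \<le> amp (arccos t) * exp ?g" using b(1) by (intro mult_right_mono) auto
      finally show ?thesis using pos by (simp add: pos_divide_le_eq mult.commute)
    qed
    with e show "amp (pi/2) / amp (arccos t) \<le> exp ?e" by linarith
    have "exp (- ?g) \<le> amp (pi/2) / amp (arccos t)"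
    proof -
      have "exp (- ?g) * amp (arccos t) \<le> exp (- ?g) * (amp (pi/2) * exp ?g)"
        using b(2) by (intro mult_left_mono) auto
      also have "\<dots> = exp (- ?g) * exp ?g * amp (pi/2)" by (simp only: mult_ac)
      also have "\<dots> = amp (pi/2)" by (simp only: exp_add[symmetric]) simp
      finally show ?thesis using pos by (simp add: pos_le_divide_eq)
    qed
    with e show "exp (- ?e) \<le> amp (pi/2) / amp (arccos t)" by linarith
  qed
  have pos: "0 \<le> \<kappa> * sin (arccos t)" if "t \<in> gauss_nodes n" for t
    using kap sin_gt_zero[OF gauss_node_angle(4,5)[OF that]] by simp
  show thesis
    by (rule that[OF kap]; subst w, assumption)
       (rule mult_left_mono[OF ratio(1) pos] mult_left_mono[OF ratio(2) pos], assumption+)+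
qed

text \<open>The angles \<open>\<phi>\<^sub>k = (k - 1/4) \<pi> / (n + 1/2)\<close>, written as odd multiples of \<open>\<pi> / (4 n + 2)\<close>.\<close>

definition gauss_angle :: "nat \<Rightarrow> nat \<Rightarrow> real" where
  "gauss_angle n k = (4 * real k - 1) * (pi / (4 * real n + 2))"

lemma gauss_angle_eq: "(real n + 1/2) * gauss_angle n k = (real k - 1/4) * pi"
  by (simp add: gauss_angle_def field_simps)

text \<open>At a node the phase is an odd multiple of \<open>\<pi>/2\<close>, and it lies strictly between \<open>0\<close> and \<open>n \<pi>\<close>.
  As the phase is strictly increasing, distinct nodes have distinct phases, and the \<open>n\<close> nodes must use up
  all \<open>n\<close> possible values.\<close>

lemma gauss_nodes_index:
  obtains K where "bij_betw K (gauss_nodes n) {1..n}"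
    "\<And>t. t \<in> gauss_nodes n \<Longrightarrow>
       \<bar>arccos t - gauss_angle n (K t)\<bar> \<le> 1 / (4 * (real n + 1/2)\<^sup>2 * sin (arccos t))"
proof -
  define \<nu> where "\<nu> = real n + 1/2"
  have nu: "\<nu> > 0" by (simp add: \<nu>_def)
  obtain \<psi> where mono: "\<And>x y. 0 < x \<Longrightarrow> x < y \<Longrightarrow> y < pi \<Longrightarrow> \<psi> x < \<psi> y" and
    close: "\<And>x. 0 < x \<Longrightarrow> x < pi \<Longrightarrow> \<bar>\<psi> x - (\<nu> * x - pi/4)\<bar> \<le> 1 / (4 * \<nu> * sin x)" and
    zero: "\<And>t. t \<in> gauss_nodes n \<Longrightarrow> cos (\<psi> (arccos t)) = 0"
    unfolding \<nu>_def by (rule gauss_nodes_phase[of n]) blast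
  have ex: "\<exists>k\<in>{1..n}. \<psi> (arccos t) = (real k - 1/2) * pi" if t: "t \<in> gauss_nodes n" for t
  proof -
    note th = gauss_node_angle[OF t, folded \<nu>_def]
    have s: "sin (arccos t) > 0" using th(4,5) by (rule sin_gt_zero)
    have "1 / (4 * \<nu> * sin (arccos t)) \<le> 1/4"
    proof -
      have "1 \<le> \<nu> * sin (arccos t)" using th(1) nu by (simp add: field_simps)
      then show ?thesis by (simp add: mult.assoc)
    qed
    with close[OF th(4,5)] have c: "\<bar>\<psi> (arccos t) - (\<nu> * arccos t - pi/4)\<bar> \<le> 1/4" by linarith
    \<comment> \<open>The phase is within \<open>1/4\<close> of \<open>\<nu> \<theta> - \<pi>/4\<close>, and \<open>2 - \<pi>/4 - 1/4 > 0\<close>.\<close>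
    have "2 \<le> \<nu> * arccos t" "2 \<le> \<nu> * (pi - arccos t)"
      using th(2,3) nu by (simp_all add: field_simps)
    moreover have "\<nu> * (pi - arccos t) = real n * pi + pi/2 - \<nu> * arccos t"
      by (simp add: \<nu>_def field_simps)
    ultimately have b: "0 < \<psi> (arccos t)" "\<psi> (arccos t) < real n * pi"
      using c pi_less_4 by linarith+
    obtain i :: int where i: "\<psi> (arccos t) = of_int i * pi + pi/2"
      using zero[OF t] by (auto simp: cos_zero_iff_int2)
    then have i': "\<psi> (arccos t) = (of_int i + 1/2) * pi" by (simp add: algebra_simps)
    have "i \<ge> 0"
    proof -
      have "0 < of_int i + (1/2::real)" using b(1) unfolding i' by (simp add: zero_less_mult_iff)
      then show ?thesis by linarith
    qed
    moreover have "i < int n"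
    proof -
      have "of_int i + 1/2 < real n" using b(2) unfolding i' by simp
      then show ?thesis by linarith
    qed
    ultimately show ?thesis
      using i' by (intro bexI[of _ "nat i + 1"]) auto
  qed
  define K where "K t = (SOME k. k \<in> {1..n} \<and> \<psi> (arccos t) = (real k - 1/2) * pi)" for t
  have K: "K t \<in> {1..n}" "\<psi> (arccos t) = (real (K t) - 1/2) * pi" if "t \<in> gauss_nodes n" for t
    using someI_ex[of "\<lambda>k. k \<in> {1..n} \<and> \<psi> (arccos t) = (real k - 1/2) * pi"] ex[OF that]
    by (auto simp: K_def)
  have "inj_on K (gauss_nodes n)"
  proof (rule inj_onI)
    fix s t assume st: "s \<in> gauss_nodes n" "t \<in> gauss_nodes n" "K s = K t"
    then have eq: "\<psi> (arccos s) = \<psi> (arccos t)" using K by simp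
    have "arccos s = arccos t"
      using mono[of "arccos s" "arccos t"] mono[of "arccos t" "arccos s"] eq
        gauss_node_angle(4,5)[OF st(1)] gauss_node_angle(4,5)[OF st(2)]
      by (cases "arccos s" "arccos t" rule: linorder_cases) auto
    then show "s = t"
      using gauss_node_angle(6)[OF st(1)] gauss_node_angle(6)[OF st(2)] by metis
  qed
  moreover from this have "K ` gauss_nodes n = {1..n}"
    using K(1) by (intro card_subset_eq) (auto simp: card_image card_gauss_nodes)
  ultimately have bij: "bij_betw K (gauss_nodes n) {1..n}" by (simp add: bij_betw_def)
  moreover have "\<bar>arccos t - gauss_angle n (K t)\<bar> \<le> 1 / (4 * \<nu>\<^sup>2 * sin (arccos t))"
    if t: "t \<in> gauss_nodes n" for t
  proof -
    note th = gauss_node_angle[OF t, folded \<nu>_def]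
    have "\<nu> * (arccos t - gauss_angle n (K t)) = - (\<psi> (arccos t) - (\<nu> * arccos t - pi/4))"
      using gauss_angle_eq[of n "K t"] K(2)[OF t] by (simp add: \<nu>_def algebra_simps)
    then have "\<nu> * \<bar>arccos t - gauss_angle n (K t)\<bar> \<le> 1 / (4 * \<nu> * sin (arccos t))"
      using close[OF th(4,5)] nu by (metis abs_minus_cancel abs_mult abs_of_pos)
    then have "\<bar>arccos t - gauss_angle n (K t)\<bar> \<le> 1 / (4 * \<nu> * sin (arccos t)) / \<nu>"
      using divide_right_mono[OF _ less_imp_le[OF nu]] nu
      by (metis nonzero_mult_div_cancel_left less_irrefl)
    then show ?thesis by (simp add: power2_eq_square mult_ac)
  qed
  ultimately show thesis using that[of K] by (simp add: \<nu>_def)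
qed

section \<open>Aliasing sums\<close>

text \<open>The quadrature sum of \<open>T\<^sub>m\<close> with the nodes \<open>cos \<phi>\<^sub>k\<close> and weights \<open>sin \<phi>\<^sub>k\<close>.\<close>

definition alias_sum :: "nat \<Rightarrow> nat \<Rightarrow> real" where
  "alias_sum n m = (\<Sum>k=1..n. sin (gauss_angle n k) * cos (real m * gauss_angle n k))"

text \<open>With \<open>x = (2 i + 1) \<pi> / (4 n + 2)\<close> the terms are \<open>sin ((4 k - 1) x)\<close>, and multiplication by
  \<open>2 sin (2 x)\<close> makes the sum telescope to \<open>2 cos x\<close>. The condition \<open>i < n\<close> keeps \<open>x\<close> below \<open>\<pi>/2\<close>;
  at \<open>i = n\<close> there is resonance and the formula fails.\<close>

lemma sum_sin_odd_multiple:
  assumes "i < n"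
  shows "(\<Sum>k=1..n. sin (real (2 * i + 1) * gauss_angle n k))
     = 1 / (2 * sin (real (2 * i + 1) * (pi / (4 * real n + 2))))"
proof -
  define \<alpha> where "\<alpha> = pi / (4 * real n + 2)"
  define x where "x = real (2 * i + 1) * \<alpha>"
  have top: "(4 * real n + 2) * \<alpha> = pi" by (simp add: \<alpha>_def)
  have ang: "real (2 * i + 1) * gauss_angle n k = (4 * real k - 1) * x" for k
    by (simp add: gauss_angle_def x_def \<alpha>_def)
  have "\<alpha> > 0" by (simp add: \<alpha>_def add_pos_pos)
  have "real (2 * i + 1) < 2 * real n + 1" using assms by simp
  then have "x < (2 * real n + 1) * \<alpha>" unfolding x_def using \<open>\<alpha> > 0\<close> by (rule mult_strict_right_mono)
  also have "\<dots> = pi / 2" using top by (simp add: algebra_simps)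
  finally have x: "0 < x" "x < pi / 2" using \<open>\<alpha> > 0\<close> by (simp_all add: x_def)
  have sc: "sin x > 0" "cos x > 0" using x by (auto intro: sin_gt_zero cos_gt_zero)
  have tele: "2 * sin (2 * x) * (\<Sum>k=1..N. sin ((4 * real k - 1) * x)) = cos x - cos ((4 * real N + 1) * x)" for N
  proof (induction N)
    case (Suc N)
    have "2 * sin (2 * x) * sin ((4 * real (Suc N) - 1) * x)
        = cos ((4 * real N + 1) * x) - cos ((4 * real (Suc N) + 1) * x)"
      using sin_times_sin[of "(4 * real (Suc N) - 1) * x" "2 * x"] by (simp add: algebra_simps)
    with Suc show ?case by (simp add: distrib_left)
  qed simp
  have "(4 * real n + 1) * x = real (2 * i + 1) * pi - x"
    unfolding x_def top[symmetric] by (simp add: algebra_simps)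
  also have "cos \<dots> = - cos x"
    unfolding cos_diff cos_npi sin_npi by simp
  finally have "cos ((4 * real n + 1) * x) = - cos x" .
  with tele[of n] have "2 * (2 * sin x * cos x) * (\<Sum>k=1..n. sin ((4 * real k - 1) * x)) = 2 * cos x"
    by (simp add: sin_double)
  with sc have "2 * sin x * (\<Sum>k=1..n. sin ((4 * real k - 1) * x)) = 1" by (simp add: field_simps)
  with sc have "(\<Sum>k=1..n. sin ((4 * real k - 1) * x)) = 1 / (2 * sin x)"
    by (simp add: field_simps)
  then show ?thesis by (simp only: ang x_def \<alpha>_def)
qed

lemma alias_sum_le: "\<bar>alias_sum n m\<bar> \<le> real n"
proof -
  have "\<bar>alias_sum n m\<bar> \<le> (\<Sum>k=1..n. \<bar>sin (gauss_angle n k) * cos (real m * gauss_angle n k)\<bar>)"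
    unfolding alias_sum_def by (rule sum_abs)
  also have "\<dots> \<le> (\<Sum>k=1..n. 1)"
    by (intro sum_mono) (auto simp: abs_mult intro!: mult_le_one)
  finally show ?thesis by simp
qed

lemma cos_multiple_reflect: "cos (real m * (pi - x)) = (-1) ^ m * cos (real m * x)"
  unfolding right_diff_distrib cos_diff by simp

lemma alias_sum_odd:
  assumes "odd m"
  shows "alias_sum n m = 0"
proof -
  have mirror: "gauss_angle n (n + 1 - k) = pi - gauss_angle n k" if "k \<in> {1..n}" for k
    using that by (simp add: gauss_angle_def of_nat_diff field_simps)
  have "alias_sum n m = (\<Sum>k=1..n. sin (gauss_angle n (n + 1 - k)) * cos (real m * gauss_angle n (n + 1 - k)))"
    unfolding alias_sum_def by (rule sum.atLeastAtMost_rev)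
  also have "\<dots> = (\<Sum>k=1..n. - (sin (gauss_angle n k) * cos (real m * gauss_angle n k)))"
  proof (rule sum.cong[OF refl])
    fix k assume "k \<in> {1..n}"
    from mirror[OF this] show "sin (gauss_angle n (n + 1 - k)) * cos (real m * gauss_angle n (n + 1 - k)) =
      - (sin (gauss_angle n k) * cos (real m * gauss_angle n k))"
      using cos_multiple_reflect[of m "gauss_angle n k"] assms by simp
  qed
  also have "\<dots> = - alias_sum n m" by (simp add: alias_sum_def sum_negf)
  finally show ?thesis by simp
qed

lemma gauss_angle_period: "real (4 * n + 2) * gauss_angle n k = (4 * real k - 1) * pi"
  by (simp add: gauss_angle_def field_simps)

lemma cos_4k_minus_1: 
  shows "cos ((4 * real k - 1) * pi) = -1" and "sin ((4 * real k - 1) * pi) = 0"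
proof -
  have *: "(4 * real k - 1) * pi = real (4 * k) * pi - real 1 * pi" by (simp add: algebra_simps)
  have "(-1::real) ^ (4 * k) = 1" by (simp add: power_mult)
  then show "cos ((4 * real k - 1) * pi) = -1" "sin ((4 * real k - 1) * pi) = 0"
    unfolding * cos_diff sin_diff cos_npi sin_npi by simp_all
qed

lemma alias_sum_period: "alias_sum n (m + (4 * n + 2)) = - alias_sum n m"
proof -
  have "cos (real (m + (4 * n + 2)) * gauss_angle n k) = - cos (real m * gauss_angle n k)" for k
    unfolding of_nat_add[of m] distrib_right[of "real m"] gauss_angle_period cos_add cos_4k_minus_1 by simp
  then show ?thesis by (simp add: alias_sum_def sum_negf)
qed

lemma alias_sum_reflect:
  assumes "m \<le> 4 * n + 2"
  shows "alias_sum n (4 * n + 2 - m) = - alias_sum n m"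
proof -
  have "cos (real (4 * n + 2 - m) * gauss_angle n k) = - cos (real m * gauss_angle n k)" for k
    unfolding of_nat_diff[OF assms] left_diff_distrib[of "real (4 * n + 2)"] gauss_angle_period
      cos_diff cos_4k_minus_1 by simp
  then show ?thesis by (simp add: alias_sum_def sum_negf)
qed

lemma alias_sum_even:
  assumes "1 \<le> i" "i < n"
  defines "B \<equiv> (\<lambda>i. 1 / (4 * sin (real (2 * i + 1) * (pi / (4 * real n + 2)))))"
  shows "alias_sum n (2 * i) = B i - B (i - 1)"
proof -
  have "alias_sum n (2 * i) = (\<Sum>k=1..n. (sin (real (2 * i + 1) * gauss_angle n k)
      - sin (real (2 * (i - 1) + 1) * gauss_angle n k)) / 2)"
    unfolding alias_sum_def
  proof (rule sum.cong[OF refl])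
    fix k
    have "real (2 * (i - 1) + 1) = real (2 * i) - 1" using assms by (simp add: of_nat_diff)
    then show "sin (gauss_angle n k) * cos (real (2 * i) * gauss_angle n k) =
      (sin (real (2 * i + 1) * gauss_angle n k) - sin (real (2 * (i - 1) + 1) * gauss_angle n k)) / 2"
      using cos_times_sin[of "real (2 * i) * gauss_angle n k" "gauss_angle n k"]
      by (simp add: algebra_simps)
  qed
  also have "\<dots> = B i - B (i - 1)"
    using assms sum_sin_odd_multiple[of i n] sum_sin_odd_multiple[of "i - 1" n]
    by (simp only: sum_divide_distrib[symmetric] sum_subtractf B_def) (simp add: field_simps)
  finally show ?thesis .
qed

lemma sin_ge_half:
  assumes "0 \<le> x" "x \<le> pi / 3"
  shows "x / 2 \<le> sin (x::real)"
proof (cases "x = 0")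
  case False
  with assms have "0 < x" by simp
  then obtain z where z: "0 < z" "z < x" "sin x - sin 0 = (x - 0) * cos z"
    using MVT2[of 0 x sin cos] by auto
  have "cos (pi / 3) \<le> cos z" using z assms by (intro cos_monotone_0_pi_le) auto
  then have "x * (1/2) \<le> x * cos z" using \<open>0 < x\<close> by (intro mult_left_mono) (auto simp: cos_60)
  with z show ?thesis by simp
qed simp

text \<open>For \<open>0 < i < n\<close> the sum \<open>S\<^bsub>2i\<^esub>\<close> is a difference of consecutive values of the decreasing function
  \<open>B\<close>, so that the absolute values telescope to at most \<open>B 0 \<le> n\<close>. The resonant term \<open>i = n\<close> is at most
  \<open>n\<close> trivially.\<close>

lemma sum_alias_half_period:
  assumes "n > 0"
  shows "(\<Sum>i=1..n. \<bar>alias_sum n (2 * i)\<bar>) \<le> 2 * real n"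
proof -
  define \<alpha> where "\<alpha> = pi / (4 * real n + 2)"
  define B where "B i = 1 / (4 * sin (real (2 * i + 1) * \<alpha>))" for i :: nat
  have al: "0 < \<alpha>" "\<alpha> \<le> pi / 3"
    unfolding \<alpha>_def using assms by (simp add: add_pos_pos, intro divide_left_mono) auto
  have B_bound: "0 < B i \<and> B i \<le> B (i - 1)" if "i < n" for i
  proof -
    have "real (2 * i + 1) * \<alpha> \<le> (2 * real n + 1) * \<alpha>"
      using that al by (intro mult_right_mono) auto
    also have "\<dots> = pi / 2" by (simp add: \<alpha>_def field_simps)
    finally have le: "real (2 * i + 1) * \<alpha> \<le> pi / 2" .
    have pos: "0 < real (2 * (i - 1) + 1) * \<alpha>" using al by (intro mult_pos_pos) auto
    have mono: "real (2 * (i - 1) + 1) * \<alpha> \<le> real (2 * i + 1) * \<alpha>"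
      using al by (intro mult_right_mono) auto
    have "0 < sin (real (2 * (i - 1) + 1) * \<alpha>)"
      using pos mono le pi_gt_zero by (intro sin_gt_zero) linarith+
    moreover have "sin (real (2 * (i - 1) + 1) * \<alpha>) \<le> sin (real (2 * i + 1) * \<alpha>)"
      using pos mono le by (intro sin_monotone_2pi_le) linarith+
    ultimately show ?thesis by (auto simp: B_def intro!: divide_left_mono mult_pos_pos)
  qed
  have "(\<Sum>i=1..N. \<bar>alias_sum n (2 * i)\<bar>) = B 0 - B N" if "N < n" for N
    using that
  proof (induction N)
    case (Suc N)
    have "alias_sum n (2 * Suc N) = B (Suc N) - B N"
      using alias_sum_even[of "Suc N" n] Suc.prems by (simp add: B_def \<alpha>_def)
    moreover have "B (Suc N) \<le> B N" using B_bound[OF Suc.prems] by simp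
    ultimately show ?case using Suc by simp
  qed simp
  from this[of "n - 1"] assms have "(\<Sum>i=1..n - 1. \<bar>alias_sum n (2 * i)\<bar>) \<le> B 0"
    using B_bound[of "n - 1"] by simp
  also have "B 0 \<le> real n"
  proof -
    have "1 / (4 * real n) \<le> \<alpha> / 2"
    proof -
      have "3 * real n \<le> pi * real n" using pi_gt3 by (intro mult_right_mono) auto
      moreover have "1 \<le> real n" using assms by simp
      ultimately have "8 * real n + 4 \<le> pi * (real n * 4)" by linarith
      then show ?thesis using assms by (simp add: \<alpha>_def field_simps)
    qed
    also have "\<dots> \<le> sin \<alpha>" using al by (intro sin_ge_half) auto
    finally show ?thesis using assms sin_gt_zero[of \<alpha>] al by (simp add: B_def field_simps)
  qed
  finally have "(\<Sum>i=1..n - 1. \<bar>alias_sum n (2 * i)\<bar>) \<le> real n" .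
  moreover have "(\<Sum>i=1..n. \<bar>alias_sum n (2 * i)\<bar>) = (\<Sum>i=1..n - 1. \<bar>alias_sum n (2 * i)\<bar>) + \<bar>alias_sum n (2 * n)\<bar>"
    using assms by (cases n) simp_all
  ultimately show ?thesis using alias_sum_le[of n "2 * n"] by linarith
qed

lemma sum_alias_period:
  assumes "n > 0"
  shows "(\<Sum>m<4 * n + 2. \<bar>alias_sum n m\<bar>) \<le> 5 * real n"
proof -
  define F where "F i = \<bar>alias_sum n (2 * i)\<bar>" for i
  have "(\<Sum>m<2 * N. \<bar>alias_sum n m\<bar>) = (\<Sum>i<N. F i)" for N
    by (induction N) (simp_all add: F_def alias_sum_odd)
  from this[of "2 * n + 1"] have "(\<Sum>m<4 * n + 2. \<bar>alias_sum n m\<bar>) = (\<Sum>i<2 * n + 1. F i)" by simp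
  also have "{..<2 * n + 1} = insert 0 ({1..n} \<union> {n + 1..2 * n})" using assms by auto
  also have "(\<Sum>i\<in>insert 0 ({1..n} \<union> {n + 1..2 * n}). F i)
      = F 0 + ((\<Sum>i=1..n. F i) + (\<Sum>i=n + 1..2 * n. F i))"
    by (subst sum.insert) (auto intro!: sum.union_disjoint)
  \<comment> \<open>the symmetry \<open>m \<mapsto> 4 n + 2 - m\<close>\<close>
  also have "(\<Sum>i=n + 1..2 * n. F i) = (\<Sum>i=1..n. F i)"
  proof (rule sum.reindex_bij_witness[of _ "\<lambda>i. 2 * n + 1 - i" "\<lambda>i. 2 * n + 1 - i"])
    fix i assume "i \<in> {n + 1..2 * n}"
    then have "2 * (2 * n + 1 - i) = 4 * n + 2 - 2 * i" by auto
    then show "F (2 * n + 1 - i) = F i"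
      using \<open>i \<in> _\<close> alias_sum_reflect[of "2 * i" n] by (auto simp: F_def)
  qed auto
  finally show ?thesis
    using sum_alias_half_period[OF assms] alias_sum_le[of n 0] by (simp add: F_def)
qed

lemma sum_alias_shifted_period:
  assumes "n > 0"
  shows "(\<Sum>m<4 * n + 2. \<bar>alias_sum n (m + j * (4 * n + 2))\<bar>) \<le> 5 * real n"
proof -
  have "\<bar>alias_sum n (m + j * (4 * n + 2))\<bar> = \<bar>alias_sum n m\<bar>" for m
  proof (induction j)
    case (Suc j)
    have "m + Suc j * (4 * n + 2) = (m + j * (4 * n + 2)) + (4 * n + 2)" by simp
    then show ?case using Suc alias_sum_period[of n "m + j * (4 * n + 2)"] by (metis abs_minus_cancel)
  qed simp
  then show ?thesis using sum_alias_period[OF assms] by simp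
qed

section \<open>Quadrature of Chebyshev polynomials\<close>

lemma abs_sin_diff_le: "\<bar>sin x - sin y\<bar> \<le> \<bar>x - y\<bar>" for x y :: real
proof -
  have "\<bar>sin ((x - y) / 2)\<bar> * \<bar>cos ((x + y) / 2)\<bar> \<le> \<bar>(x - y) / 2\<bar> * 1"
    by (intro mult_mono abs_sin_x_le_abs_x) auto
  then show ?thesis by (simp add: sin_diff_sin abs_mult)
qed

lemma abs_cos_diff_le: "\<bar>cos x - cos y\<bar> \<le> \<bar>x - y\<bar>" for x y :: real
  using abs_sin_diff_le[of "pi/2 - x" "pi/2 - y"] by (simp add: sin_diff)

text \<open>The size of \<open>\<kappa>\<close> follows from the normalization: the weights add up to \<open>2\<close> and are at least
  \<open>3/4 \<kappa> sin \<theta>\<close>, while the sum of \<open>sin \<theta>\<close> over the nodes is close to the explicit sum of \<open>sin \<phi>\<^sub>k\<close>, which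
  is at least \<open>(2 n + 1) / \<pi>\<close>.\<close>

lemma gauss_weight_bounds:
  assumes "n > 0"
  obtains \<kappa> where "0 < \<kappa>" "\<kappa> \<le> 6 / real n"
    "\<And>t. t \<in> gauss_nodes n \<Longrightarrow> \<bar>gauss_weight n t - \<kappa> * sin (arccos t)\<bar> \<le> \<kappa> / (2 * (real n + 1/2))"
    "\<And>t. t \<in> gauss_nodes n \<Longrightarrow> gauss_weight n t \<le> 3/2 * \<kappa> * sin (arccos t)"
proof -
  define \<nu> where "\<nu> = real n + 1/2"
  have nu: "\<nu> > 0" "\<nu> \<ge> 1" using assms by (simp_all add: \<nu>_def)
  obtain \<kappa> where kap: "\<kappa> > 0" and
    up: "\<And>t. t \<in> gauss_nodes n \<Longrightarrow> gauss_weight n t \<le> \<kappa> * sin (arccos t) * exp (1 / (4 * \<nu> * sin (arccos t)))" and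
    lo: "\<And>t. t \<in> gauss_nodes n \<Longrightarrow> \<kappa> * sin (arccos t) * exp (- (1 / (4 * \<nu> * sin (arccos t)))) \<le> gauss_weight n t"
    unfolding \<nu>_def by (rule gauss_weight_shape[of n]) blast
  have main: "gauss_weight n t \<le> 3/2 * \<kappa> * sin (arccos t) \<and> 3/4 * \<kappa> * sin (arccos t) \<le> gauss_weight n t \<and>
      \<bar>gauss_weight n t - \<kappa> * sin (arccos t)\<bar> \<le> \<kappa> / (2 * \<nu>)" if t: "t \<in> gauss_nodes n" for t
  proof -
    note th = gauss_node_angle[OF t, folded \<nu>_def]
    define s where "s = sin (arccos t)"
    define x where "x = 1 / (4 * \<nu> * s)"
    have s: "s > 0" unfolding s_def using th(4,5) by (rule sin_gt_zero)
    have "1 \<le> \<nu> * s" using th(1) nu by (simp add: field_simps s_def)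
    then have x: "0 \<le> x" "x \<le> 1/4" using nu s by (simp_all add: x_def mult.assoc)
    have sx: "s * x = 1 / (4 * \<nu>)" using s by (simp add: x_def)
    have ks: "0 \<le> \<kappa> * s" using kap s by simp
    have "gauss_weight n t \<le> \<kappa> * s * exp x" using up[OF t] by (simp add: s_def x_def)
    also have "\<dots> \<le> \<kappa> * s * (1 + 2 * x)"
      using x ks by (intro mult_left_mono real_exp_bound_lemma) auto
    finally have 1: "gauss_weight n t \<le> \<kappa> * s * (1 + 2 * x)" .
    have "\<kappa> * s * (1 - x) \<le> \<kappa> * s * exp (- x)"
      using ks exp_ge_add_one_self[of "- x"] by (intro mult_left_mono) auto
    also have "\<dots> \<le> gauss_weight n t" using lo[OF t] by (simp add: s_def x_def)
    finally have 2: "\<kappa> * s * (1 - x) \<le> gauss_weight n t" .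
    have 3: "\<kappa> * s * (1 + 2 * x) \<le> \<kappa> * s * (3/2)" "\<kappa> * s * (3/4) \<le> \<kappa> * s * (1 - x)"
      using x ks by (intro mult_left_mono; simp)+
    have "\<kappa> * s * (1 + 2 * x) = \<kappa> * s + 2 * (\<kappa> * (s * x))" "\<kappa> * s * (1 - x) = \<kappa> * s - \<kappa> * (s * x)"
      by (simp_all add: algebra_simps)
    moreover have "\<kappa> * (s * x) \<ge> 0" using kap s x by simp
    moreover have "\<bar>w - P\<bar> \<le> 2 * Q" if "w \<le> P + 2 * Q" "P - Q \<le> w" "Q \<ge> 0" for w P Q :: real
      using that by (auto simp: abs_le_iff)
    ultimately have "\<bar>gauss_weight n t - \<kappa> * s\<bar> \<le> 2 * (\<kappa> * (s * x))" using 1 2 by metis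
    then have "\<bar>gauss_weight n t - \<kappa> * s\<bar> \<le> \<kappa> / (2 * \<nu>)" by (simp add: sx)
    moreover have "gauss_weight n t \<le> 3/2 * \<kappa> * s" "3/4 * \<kappa> * s \<le> gauss_weight n t"
      using order.trans[OF 1 3(1)] order.trans[OF 3(2) 2] by (simp_all add: mult_ac)
    ultimately show ?thesis by (simp add: s_def)
  qed
  obtain K where K: "bij_betw K (gauss_nodes n) {1..n}"
    "\<And>t. t \<in> gauss_nodes n \<Longrightarrow> \<bar>arccos t - gauss_angle n (K t)\<bar> \<le> 1 / (4 * \<nu>\<^sup>2 * sin (arccos t))"
    unfolding \<nu>_def by (rule gauss_nodes_index[of n]) blast
  define S where "S = (\<Sum>t\<in>gauss_nodes n. sin (arccos t))"
  have "(\<Sum>k=1..n. sin (gauss_angle n k)) = (\<Sum>t\<in>gauss_nodes n. sin (gauss_angle n (K t)))"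
    using sum.reindex_bij_betw[OF K(1), of "\<lambda>k. sin (gauss_angle n k)"] by simp
  also have "\<dots> \<le> (\<Sum>t\<in>gauss_nodes n. sin (arccos t) + 1 / (4 * \<nu>))"
  proof (rule sum_mono)
    fix t assume t: "t \<in> gauss_nodes n"
    note th = gauss_node_angle[OF t, folded \<nu>_def]
    have "1 \<le> \<nu> * sin (arccos t)" using th(1) nu by (simp add: field_simps)
    then have "4 * \<nu> \<le> 4 * \<nu>\<^sup>2 * sin (arccos t)"
      using nu by (simp add: power2_eq_square mult.assoc)
    then have "1 / (4 * \<nu>\<^sup>2 * sin (arccos t)) \<le> 1 / (4 * \<nu>)"
      using nu by (intro divide_left_mono) (auto intro!: mult_pos_pos sin_gt_zero th)
    then have "\<bar>gauss_angle n (K t) - arccos t\<bar> \<le> 1 / (4 * \<nu>)" using K(2)[OF t] by linarith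
    moreover have "\<bar>sin (gauss_angle n (K t)) - sin (arccos t)\<bar> \<le> \<bar>gauss_angle n (K t) - arccos t\<bar>"
      by (rule abs_sin_diff_le)
    ultimately show "sin (gauss_angle n (K t)) \<le> sin (arccos t) + 1 / (4 * \<nu>)" by linarith
  qed
  also have "\<dots> = S + real n / (4 * \<nu>)" by (simp add: sum.distrib S_def card_gauss_nodes)
  also have "real n / (4 * \<nu>) \<le> 1/4" using nu by (simp add: \<nu>_def field_simps)
  finally have S1: "(\<Sum>k=1..n. sin (gauss_angle n k)) \<le> S + 1/4" by simp
  have "(\<Sum>k=1..n. sin (gauss_angle n k)) = 1 / (2 * sin (pi / (4 * real n + 2)))"
    using sum_sin_odd_multiple[of 0 n] assms by simp
  also have "\<dots> \<ge> 1 / (2 * (pi / (4 * real n + 2)))"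
  proof -
    define \<alpha> where "\<alpha> = pi / (4 * real n + 2)"
    have "0 < \<alpha>" by (simp add: \<alpha>_def add_pos_pos)
    moreover have "\<alpha> < pi"
    proof -
      have "pi * 1 < pi * (4 * real n + 2)" by (intro mult_strict_left_mono) auto
      then show ?thesis by (simp add: \<alpha>_def divide_less_eq)
    qed
    ultimately have "0 < sin \<alpha>" "sin \<alpha> \<le> \<alpha>" using sin_x_le_x[of \<alpha>] by (auto intro: sin_gt_zero)
    then show ?thesis unfolding \<alpha>_def[symmetric] by (intro divide_left_mono) auto
  qed
  also have "1 / (2 * (pi / (4 * real n + 2))) = (2 * real n + 1) / pi" by (simp add: field_simps)
  also have "(2 * real n + 1) / pi \<ge> (2 * real n + 1) / 4"
    using pi_less_4 by (intro divide_left_mono) auto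
  finally have S2: "real n / 2 \<le> S" using S1 by simp
  have "3/4 * \<kappa> * (real n / 2) \<le> 3/4 * \<kappa> * S" using S2 kap by (intro mult_left_mono) auto
  also have "\<dots> \<le> (\<Sum>t\<in>gauss_nodes n. gauss_weight n t)"
    unfolding S_def sum_distrib_left using main by (intro sum_mono) auto
  also have "\<dots> = 2" by (rule sum_gauss_weight[OF assms])
  finally have "\<kappa> \<le> 6 / real n" using assms kap by (simp add: field_simps)
  then show thesis using that[of \<kappa>] kap main by (auto simp: \<nu>_def)
qed

text \<open>The angle error \<open>1 / (4 \<nu>\<^sup>2 sin \<theta>)\<close> blows up towards the endpoints, but it enters multiplied with the
  weight, which is of order \<open>\<kappa> sin \<theta>\<close>: each node contributes an error of order \<open>\<kappa> m / n\<^sup>2\<close>, and there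
  are \<open>n\<close> nodes with \<open>\<kappa> = O(1/n)\<close>. The errors of order \<open>\<kappa> / n\<close> from the weights and from \<open>sin \<phi>\<^sub>k\<close> are of no
  larger order because \<open>m \<ge> 2 n\<close>.\<close>

lemma gauss_rule_cheb_T_alias:
  assumes "n > 0" "2 * n \<le> m"
  shows "\<bar>gauss_rule n (cheb_T m)\<bar> \<le> 6 / real n * \<bar>alias_sum n m\<bar> + 5 * real m / (real n)\<^sup>2"
proof -
  define \<nu> where "\<nu> = real n + 1/2"
  have nu: "\<nu> > 0" "\<nu> \<ge> real n" using assms by (simp_all add: \<nu>_def)
  obtain \<kappa> where kap: "0 < \<kappa>" "\<kappa> \<le> 6 / real n" and
    w: "\<And>t. t \<in> gauss_nodes n \<Longrightarrow> \<bar>gauss_weight n t - \<kappa> * sin (arccos t)\<bar> \<le> \<kappa> / (2 * \<nu>)" and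
    w_le: "\<And>t. t \<in> gauss_nodes n \<Longrightarrow> gauss_weight n t \<le> 3/2 * \<kappa> * sin (arccos t)"
    unfolding \<nu>_def by (rule gauss_weight_bounds[OF assms(1)]) blast
  obtain K where K: "bij_betw K (gauss_nodes n) {1..n}"
    "\<And>t. t \<in> gauss_nodes n \<Longrightarrow> \<bar>arccos t - gauss_angle n (K t)\<bar> \<le> 1 / (4 * \<nu>\<^sup>2 * sin (arccos t))"
    unfolding \<nu>_def by (rule gauss_nodes_index[of n]) blast
  define C where "C = \<kappa> * (3 * real m / (8 * (real n)\<^sup>2) + 3 / (4 * real n))"
  have pt: "\<bar>gauss_weight n t * cheb_T m t - \<kappa> * (sin (gauss_angle n (K t)) * cos (real m * gauss_angle n (K t)))\<bar> \<le> C"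
    if t: "t \<in> gauss_nodes n" for t
  proof -
    note th = gauss_node_angle[OF t, folded \<nu>_def]
    define \<theta> where "\<theta> = arccos t"
    define \<phi> where "\<phi> = gauss_angle n (K t)"
    define W where "W = gauss_weight n t"
    have s: "sin \<theta> > 0" unfolding \<theta>_def using th(4,5) by (rule sin_gt_zero)
    have W: "0 < W" "W \<le> 3/2 * \<kappa> * sin \<theta>" "\<bar>W - \<kappa> * sin \<theta>\<bar> \<le> \<kappa> / (2 * \<nu>)"
      using gauss_weight_pos[OF t] w_le[OF t] w[OF t] by (simp_all add: W_def \<theta>_def)
    have d: "\<bar>\<theta> - \<phi>\<bar> \<le> 1 / (4 * \<nu>\<^sup>2 * sin \<theta>)" using K(2)[OF t] by (simp add: \<theta>_def \<phi>_def)
    have "\<bar>W * (cos (real m * \<theta>) - cos (real m * \<phi>))\<bar> \<le> W * \<bar>real m * \<theta> - real m * \<phi>\<bar>"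
      using W(1) by (simp add: abs_mult mult_left_mono abs_cos_diff_le)
    also have "\<dots> = W * (real m * \<bar>\<theta> - \<phi>\<bar>)" by (simp flip: right_diff_distrib add: abs_mult)
    also have "\<dots> \<le> (3/2 * \<kappa> * sin \<theta>) * (real m * (1 / (4 * \<nu>\<^sup>2 * sin \<theta>)))"
      using W d kap s by (intro mult_mono mult_left_mono) auto
    also have "\<dots> = \<kappa> * (3 * real m / (8 * \<nu>\<^sup>2))" using s by (simp add: field_simps)
    finally have 1: "\<bar>W * (cos (real m * \<theta>) - cos (real m * \<phi>))\<bar> \<le> \<kappa> * (3 * real m / (8 * \<nu>\<^sup>2))" .
    have "\<bar>(W - \<kappa> * sin \<theta>) * cos (real m * \<phi>)\<bar> \<le> \<kappa> / (2 * \<nu>) * 1"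
      unfolding abs_mult using W(3) by (intro mult_mono) auto
    then have 2: "\<bar>(W - \<kappa> * sin \<theta>) * cos (real m * \<phi>)\<bar> \<le> \<kappa> * (1 / (2 * \<nu>))" by simp
    have "1 \<le> \<nu> * sin \<theta>" using th(1) nu by (simp add: field_simps \<theta>_def)
    then have "4 * \<nu> \<le> 4 * \<nu>\<^sup>2 * sin \<theta>" using nu by (simp add: power2_eq_square mult.assoc)
    then have "1 / (4 * \<nu>\<^sup>2 * sin \<theta>) \<le> 1 / (4 * \<nu>)"
      using nu s by (intro divide_left_mono) (auto intro!: mult_pos_pos)
    with d abs_sin_diff_le[of \<theta> \<phi>] have "\<bar>sin \<theta> - sin \<phi>\<bar> \<le> 1 / (4 * \<nu>)" by linarith
    then have "\<bar>(\<kappa> * (sin \<theta> - sin \<phi>)) * cos (real m * \<phi>)\<bar> \<le> (\<kappa> * (1 / (4 * \<nu>))) * 1"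
      unfolding abs_mult using kap nu by (intro mult_mono) auto
    then have 3: "\<bar>(\<kappa> * (sin \<theta> - sin \<phi>)) * cos (real m * \<phi>)\<bar> \<le> \<kappa> * (1 / (4 * \<nu>))" by simp
    \<comment> \<open>The node, the weight and the sine are replaced one after the other.\<close>
    have "W * cos (real m * \<theta>) - \<kappa> * (sin \<phi> * cos (real m * \<phi>))
      = W * (cos (real m * \<theta>) - cos (real m * \<phi>)) + (W - \<kappa> * sin \<theta>) * cos (real m * \<phi>)
        + (\<kappa> * (sin \<theta> - sin \<phi>)) * cos (real m * \<phi>)"
      by (simp add: algebra_simps)
    with 1 2 3 have "\<bar>W * cos (real m * \<theta>) - \<kappa> * (sin \<phi> * cos (real m * \<phi>))\<bar>
      \<le> \<kappa> * (3 * real m / (8 * \<nu>\<^sup>2)) + \<kappa> * (1 / (2 * \<nu>)) + \<kappa> * (1 / (4 * \<nu>))" by linarith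
    also have "\<dots> = \<kappa> * (3 * real m / (8 * \<nu>\<^sup>2) + 3 / (4 * \<nu>))"
      using nu by (simp add: field_simps)
    also have "\<dots> \<le> C"
      unfolding C_def using nu kap assms
      by (intro mult_left_mono add_mono divide_left_mono power_mono) auto
    finally show ?thesis by (simp add: W_def \<theta>_def \<phi>_def cheb_T_def)
  qed
  have "\<kappa> * alias_sum n m
      = (\<Sum>t\<in>gauss_nodes n. \<kappa> * (sin (gauss_angle n (K t)) * cos (real m * gauss_angle n (K t))))"
    unfolding alias_sum_def sum_distrib_left
    using sum.reindex_bij_betw[OF K(1), of "\<lambda>k. \<kappa> * (sin (gauss_angle n k) * cos (real m * gauss_angle n k))"]
    by simp
  then have "\<bar>gauss_rule n (cheb_T m) - \<kappa> * alias_sum n m\<bar>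
    = \<bar>\<Sum>t\<in>gauss_nodes n. gauss_weight n t * cheb_T m t - \<kappa> * (sin (gauss_angle n (K t)) * cos (real m * gauss_angle n (K t)))\<bar>"
    by (simp add: gauss_rule_def sum_subtractf)
  also have "\<dots> \<le> (\<Sum>t\<in>gauss_nodes n. C)"
    by (rule order.trans[OF sum_abs]) (intro sum_mono pt)
  also have "\<dots> = real n * C" by (simp add: card_gauss_nodes)
  also have "\<dots> \<le> real n * (6 / real n * (3 * real m / (8 * (real n)\<^sup>2) + 3 / (4 * real n)))"
    unfolding C_def using kap by (intro mult_left_mono mult_right_mono) auto
  also have "\<dots> = 6 * (3 * real m / (8 * (real n)\<^sup>2)) + 6 * (3 / (4 * real n))"
    using assms by (simp add: field_simps)
  also have "\<dots> \<le> 5 * real m / (real n)\<^sup>2"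
  proof -
    have "1 / real n = real n / (real n)\<^sup>2" by (simp add: power2_eq_square)
    also have "\<dots> \<le> (real m / 2) / (real n)\<^sup>2" using assms by (intro divide_right_mono) auto
    finally have "1 / real n \<le> real m / (real n)\<^sup>2 / 2" by simp
    moreover have "0 \<le> real m / (real n)\<^sup>2" by simp
    moreover have "9/4 * q + 9/2 * p \<le> 5 * q" if "p \<le> q / 2" "0 \<le> q" for p q :: real
      using that by simp
    ultimately have "9/4 * (real m / (real n)\<^sup>2) + 9/2 * (1 / real n) \<le> 5 * (real m / (real n)\<^sup>2)"
      by blast
    moreover have "6 * (3 * real m / (8 * (real n)\<^sup>2)) + 6 * (3 / (4 * real n))
      = 9/4 * (real m / (real n)\<^sup>2) + 9/2 * (1 / real n)" by simp
    ultimately show ?thesis by (simp only: times_divide_eq_right)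
  qed
  finally have "\<bar>gauss_rule n (cheb_T m) - \<kappa> * alias_sum n m\<bar> \<le> 5 * real m / (real n)\<^sup>2" .
  moreover have "\<bar>\<kappa> * alias_sum n m\<bar> \<le> 6 / real n * \<bar>alias_sum n m\<bar>"
    unfolding abs_mult using kap by (intro mult_right_mono) auto
  ultimately show ?thesis by linarith
qed

lemma cheb_T_abs_le: "\<bar>cheb_T m x\<bar> \<le> 1"
  by (simp add: cheb_T_def)

lemma gauss_rule_le:
  assumes "n > 0" "\<And>t. t \<in> {-1..1} \<Longrightarrow> \<bar>g t\<bar> \<le> M"
  shows "\<bar>gauss_rule n g\<bar> \<le> 2 * M"
proof -
  have "\<bar>gauss_rule n g\<bar> \<le> (\<Sum>t\<in>gauss_nodes n. gauss_weight n t * M)"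
    unfolding gauss_rule_def
  proof (rule order.trans[OF sum_abs], rule sum_mono)
    fix t assume t: "t \<in> gauss_nodes n"
    then have "\<bar>g t\<bar> \<le> M" using assms(2)[of t] gauss_nodes_in[OF t] by simp
    then show "\<bar>gauss_weight n t * g t\<bar> \<le> gauss_weight n t * M"
      using gauss_weight_pos[OF t] by (simp add: abs_mult)
  qed
  also have "\<dots> = 2 * M" using sum_gauss_weight[OF assms(1)] by (simp flip: sum_distrib_right)
  finally show ?thesis .
qed

lemma continuous_cheb_T: "continuous_on {-1..1} (cheb_T m)"
  unfolding cheb_T_def[abs_def] by (intro continuous_intros) auto

text \<open>An antiderivative of \<open>T\<^sub>m\<close> is \<open>T\<^bsub>m+1\<^esub> / (2 (m + 1)) - T\<^bsub>m-1\<^esub> / (2 (m - 1))\<close>.\<close>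

lemma integral_cheb_T_le:
  assumes "m \<ge> 2"
  shows "\<bar>integral {-1..1} (cheb_T m)\<bar> \<le> 4 / real m"
proof -
  define F where "F x = cheb_T (m + 1) x / (2 * real (m + 1)) - cheb_T (m - 1) x / (2 * real (m - 1))" for x
  have "(cheb_T m has_integral (F 1 - F (-1))) {-1..1}"
  proof (rule fundamental_theorem_of_calculus_interior)
    show "continuous_on {-1..1} F"
      unfolding F_def[abs_def] by (intro continuous_intros continuous_cheb_T) (use assms in auto)
    fix x :: real assume x: "x \<in> {-1<..<1}"
    define \<theta> where "\<theta> = arccos x"
    have th: "0 < \<theta>" "\<theta> < pi" using x arccos_lt_bounded[of x] by (auto simp: \<theta>_def)
    have s: "sin \<theta> > 0" using th by (rule sin_gt_zero)
    have "sqrt (1 - x\<^sup>2) = sin \<theta>" using x by (simp add: \<theta>_def sin_arccos)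
    then have dth: "(arccos has_real_derivative - (1 / sin \<theta>)) (at x)"
      using DERIV_arccos[of x] x by (simp add: inverse_eq_divide)
    have dT: "(cheb_T j has_real_derivative real j * sin (real j * \<theta>) / sin \<theta>) (at x)" for j
      unfolding cheb_T_def[abs_def]
      by (rule DERIV_cong[OF DERIV_chain2[OF DERIV_cos DERIV_cmult[OF dth]]]) (simp add: \<theta>_def)
    have "(F has_real_derivative real (m + 1) * sin (real (m + 1) * \<theta>) / sin \<theta> / (2 * real (m + 1))
        - real (m - 1) * sin (real (m - 1) * \<theta>) / sin \<theta> / (2 * real (m - 1))) (at x)"
      unfolding F_def[abs_def] by (intro DERIV_diff DERIV_cdivide dT)
    moreover have "real (m + 1) * sin (real (m + 1) * \<theta>) / sin \<theta> / (2 * real (m + 1))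
        - real (m - 1) * sin (real (m - 1) * \<theta>) / sin \<theta> / (2 * real (m - 1)) = cheb_T m x"
    proof -
      have "sin (real (m + 1) * \<theta>) - sin (real (m - 1) * \<theta>) = 2 * cos (real m * \<theta>) * sin \<theta>"
        using assms cos_times_sin[of "real m * \<theta>" \<theta>] by (simp add: of_nat_diff algebra_simps)
      moreover have "real (m - 1) \<noteq> 0" "real (m + 1) \<noteq> 0" using assms by simp_all
      moreover have "N * a / d / (2 * N) - M * b / d / (2 * M) = (a - b) / (2 * d)"
        if "M \<noteq> 0" "N \<noteq> 0" for M N a b d :: real
        using that by (simp add: diff_divide_distrib)
      ultimately have "real (m + 1) * sin (real (m + 1) * \<theta>) / sin \<theta> / (2 * real (m + 1))
          - real (m - 1) * sin (real (m - 1) * \<theta>) / sin \<theta> / (2 * real (m - 1))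
          = 2 * cos (real m * \<theta>) * sin \<theta> / (2 * sin \<theta>)" by metis
      then show ?thesis using s by (simp add: cheb_T_def \<theta>_def)
    qed
    ultimately show "(F has_vector_derivative cheb_T m x) (at x)"
      by (simp add: has_real_derivative_iff_has_vector_derivative)
  qed simp
  then have "integral {-1..1} (cheb_T m) = F 1 - F (-1)" by (rule integral_unique)
  moreover have "\<bar>F x\<bar> \<le> 2 / real m" for x
  proof -
    have "\<bar>cheb_T j x / (2 * real j)\<bar> \<le> 1 / (2 * real j)" for j
      using cheb_T_abs_le[of j x] by (simp add: abs_divide divide_right_mono)
    from this[of "m + 1"] this[of "m - 1"]
    have "\<bar>F x\<bar> \<le> 1 / (2 * real (m + 1)) + 1 / (2 * real (m - 1))"
      unfolding F_def by (rule order.trans[OF abs_triangle_ineq4 add_mono])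
    also have "1 / (2 * real (m + 1)) \<le> 1 / real m" using assms by (intro divide_left_mono) auto
    also have "1 / (2 * real (m - 1)) \<le> 1 / real m" using assms by (intro divide_left_mono) auto
    finally show ?thesis by simp
  qed
  from this[of 1] this[of "-1"] have "\<bar>F 1 - F (-1)\<bar> \<le> 4 / real m" by linarith
  ultimately show ?thesis by simp
qed

fun cheb_poly :: "nat \<Rightarrow> real poly" where
  "cheb_poly 0 = 1"
| "cheb_poly (Suc 0) = [:0, 1:]"
| "cheb_poly (Suc (Suc n)) = [:0, 2:] * cheb_poly (Suc n) - cheb_poly n"

lemma cheb_poly: "x \<in> {-1..1} \<Longrightarrow> poly (cheb_poly n) x = cheb_T n x"
proof (induction n rule: cheb_poly.induct)
  case (3 n)
  have "cos (real (Suc (Suc n)) * arccos x) + cos (real n * arccos x)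
      = 2 * cos (arccos x) * cos (real (Suc n) * arccos x)"
    using cos_times_cos[of "real (Suc n) * arccos x" "arccos x"] by (simp add: algebra_simps)
  with 3 show ?case by (simp add: cheb_T_def)
qed (auto simp: cheb_T_def)

lemma degree_cheb_poly: "degree (cheb_poly n) \<le> n"
proof (induction n rule: cheb_poly.induct)
  case (3 n)
  have "degree ([:0, 2:] * cheb_poly (Suc n)) \<le> Suc (Suc n)"
    using degree_mult_le[of "[:0, 2::real:]" "cheb_poly (Suc n)"] 3 by (simp del: mult_pCons_left)
  then show ?case using 3 by (simp add: degree_diff_le del: mult_pCons_left)
qed auto

lemma gauss_error_cheb_T_exact:
  assumes "m < 2 * n"
  shows "gauss_error n (cheb_T m) = 0"
proof -
  have "integral {-1..1} (poly (cheb_poly m)) = integral {-1..1} (cheb_T m)"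
    by (intro integral_cong cheb_poly)
  moreover have "gauss_rule n (poly (cheb_poly m)) = gauss_rule n (cheb_T m)"
    unfolding gauss_rule_def
  proof (rule sum.cong[OF refl])
    fix t assume "t \<in> gauss_nodes n"
    then have "t \<in> {-1..1}" using gauss_nodes_in[of t n] by simp
    then show "gauss_weight n t * poly (cheb_poly m) t = gauss_weight n t * cheb_T m t"
      by (simp add: cheb_poly)
  qed
  ultimately show ?thesis
    using gauss_exact[of "cheb_poly m" n] degree_cheb_poly[of m] assms by (simp add: gauss_error_def)
qed

lemma gauss_error_cheb_T_le:
  assumes "n > 0" "2 * n \<le> m"
  shows "\<bar>gauss_error n (cheb_T m)\<bar>
    \<le> 4 / real m + 6 / real n * \<bar>alias_sum n m\<bar> + 5 * min (real m / (real n)\<^sup>2) 1"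
proof -
  have "\<bar>gauss_rule n (cheb_T m)\<bar> \<le> 2"
    using gauss_rule_le[OF assms(1), of "cheb_T m" 1] cheb_T_abs_le by simp
  moreover have "0 \<le> 6 / real n * \<bar>alias_sum n m\<bar>" by simp
  ultimately have "\<bar>gauss_rule n (cheb_T m)\<bar> \<le> 6 / real n * \<bar>alias_sum n m\<bar> + 5 * min (real m / (real n)\<^sup>2) 1"
  proof -
    have "r \<le> a + 5 * min x 1" if "r \<le> 2" "0 \<le> a" "r \<le> a + 5 * x" for r a x :: real
      using that by (auto simp: min_def)
    from this[OF \<open>\<bar>gauss_rule n (cheb_T m)\<bar> \<le> 2\<close> \<open>0 \<le> 6 / real n * \<bar>alias_sum n m\<bar>\<close>] show ?thesis
      using gauss_rule_cheb_T_alias[OF assms] by (simp only: times_divide_eq_right)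
  qed
  moreover have "\<bar>integral {-1..1} (cheb_T m)\<bar> \<le> 4 / real m"
    using assms by (intro integral_cheb_T_le) auto
  ultimately show ?thesis unfolding gauss_error_def by linarith
qed

section \<open>Summation over the Chebyshev series\<close>

lemma gauss_error_tendsto:
  assumes lim: "uniform_limit {-1..1} p f sequentially" and cont: "\<And>N. continuous_on {-1..1} (p N)"
  shows "(\<lambda>N. gauss_error n (p N)) \<longlonglongrightarrow> gauss_error n f"
proof -
  obtain I J where IJ: "\<And>N. (p N has_integral I N) {-1..1}" "(f has_integral J) {-1..1}" "I \<longlonglongrightarrow> J"
    using uniform_limit_integral[OF lim cont] by auto
  have "(\<lambda>N. gauss_rule n (p N)) \<longlonglongrightarrow> gauss_rule n f"
    unfolding gauss_rule_def
  proof (intro tendsto_sum tendsto_mult tendsto_const tendsto_uniform_limitI[OF lim])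
    show "t \<in> {-1..1}" if "t \<in> gauss_nodes n" for t using gauss_nodes_in[OF that] by simp
  qed
  moreover have "I = (\<lambda>N. integral {-1..1} (p N))" "J = integral {-1..1} f"
    using IJ(1,2) by (auto simp: fun_eq_iff intro!: integral_unique[symmetric])
  ultimately show ?thesis unfolding gauss_error_def using IJ(3) by (auto intro: tendsto_diff)
qed

lemma gauss_error_add:
  assumes "continuous_on {-1..1} g" "continuous_on {-1..1} h"
  shows "gauss_error n (\<lambda>x. g x + h x) = gauss_error n g + gauss_error n h"
  using integral_add[OF integrable_continuous_interval[OF assms(1)] integrable_continuous_interval[OF assms(2)]]
  by (simp add: gauss_error_def gauss_rule_def sum.distrib distrib_left)

lemma gauss_error_cmult: "gauss_error n (\<lambda>x. c * g x) = c * gauss_error n g"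
  by (simp add: gauss_error_def gauss_rule_def sum_distrib_left right_diff_distrib mult.left_commute)

lemma continuous_cheb_partial_sum: "continuous_on {-1..1} (cheb_partial_sum f N)"
  unfolding cheb_partial_sum_def[abs_def] by (intro continuous_intros continuous_cheb_T)

lemma gauss_error_cheb_partial_sum:
  assumes "n > 0"
  shows "gauss_error n (cheb_partial_sum f N) = (\<Sum>j=2 * n..N. cheb_coeff f j * gauss_error n (cheb_T j))"
proof -
  have "gauss_error n (cheb_partial_sum f N) = (\<Sum>j=1..N. cheb_coeff f j * gauss_error n (cheb_T j))"
  proof (induction N)
    case 0
    have "cheb_partial_sum f 0 = (\<lambda>x. cheb_coeff f 0 / 2 * cheb_T 0 x)"
      by (simp add: cheb_partial_sum_def cheb_T_def fun_eq_iff)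
    then show ?case
      using gauss_error_cmult[of n "cheb_coeff f 0 / 2" "cheb_T 0"] gauss_error_cheb_T_exact[of 0 n] assms
      by simp
  next
    case (Suc N)
    have "cheb_partial_sum f (Suc N) = (\<lambda>x. cheb_partial_sum f N x + cheb_coeff f (Suc N) * cheb_T (Suc N) x)"
      by (simp add: cheb_partial_sum_def fun_eq_iff)
    then show ?case
      using Suc gauss_error_cmult[of n "cheb_coeff f (Suc N)" "cheb_T (Suc N)"]
      by (simp add: gauss_error_add continuous_cheb_partial_sum continuous_cheb_T continuous_on_mult_left)
  qed
  also have "\<dots> = (\<Sum>j=2 * n..N. cheb_coeff f j * gauss_error n (cheb_T j))"
    using assms by (intro sum.mono_neutral_right) (auto simp: gauss_error_cheb_T_exact)
  finally show ?thesis .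
qed

lemma sum_le_antiderivative:
  fixes F g :: "real \<Rightarrow> real" and M N :: nat
  assumes "M \<le> N" "0 < M"
    and F: "\<And>x. x \<ge> real M \<Longrightarrow> (F has_real_derivative g x) (at x)"
    and mono: "\<And>x y. real M \<le> x \<Longrightarrow> x \<le> y \<Longrightarrow> g y \<le> g x"
  shows "(\<Sum>j=Suc M..N. g (real j)) \<le> F (real N) - F (real M)"
  using \<open>M \<le> N\<close>
proof (induction N rule: dec_induct)
  case (step N)
  obtain z where z: "real N < z" "z < real N + 1" "F (real N + 1) - F (real N) = (real N + 1 - real N) * g z"
    using MVT2[of "real N" "real N + 1" F g] F step.hyps by auto
  then have "g (real (Suc N)) \<le> F (real (Suc N)) - F (real N)"
    using mono[of z "real (Suc N)"] step.hyps by (simp add: add.commute)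
  then show ?case using step by (simp add: sum.atLeast_Suc_atMost sum.cl_ivl_Suc)
qed simp

lemma sum_powr_le:
  assumes "M \<le> N" "0 < M" "a \<noteq> 1" "a > 0"
  shows "(\<Sum>j=Suc M..N. real j powr (- a)) \<le> (real N powr (1 - a) - real M powr (1 - a)) / (1 - a)"
proof -
  have "(\<Sum>j=Suc M..N. real j powr (- a)) \<le> real N powr (1 - a) / (1 - a) - real M powr (1 - a) / (1 - a)"
  proof (rule sum_le_antiderivative[OF assms(1,2)])
    fix x :: real assume "real M \<le> x"
    then have x: "x > 0" using assms by linarith
    then show "((\<lambda>x. x powr (1 - a) / (1 - a)) has_real_derivative x powr (- a)) (at x)"
      using DERIV_cdivide[OF has_real_derivative_powr[OF x, of "1 - a"], of "1 - a"] assms by simp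
    show "y powr (- a) \<le> x powr (- a)" if "x \<le> y" for y
      using x that assms by (intro powr_mono2') auto
  qed
  then show ?thesis by (simp add: diff_divide_distrib)
qed

lemma sum_powr_tail:
  assumes "0 < M" "s > 0"
  shows "(\<Sum>j=Suc M..N. real j powr (- s - 1)) \<le> real M powr (- s) / s"
proof (cases "M \<le> N")
  case True
  have "(real N powr (- s) - real M powr (- s)) / (- s) \<le> real M powr (- s) / s"
    using assms by (simp add: field_simps)
  moreover have "- (s + 1) = - s - 1" "1 - (s + 1) = - s" by simp_all
  ultimately show ?thesis using sum_powr_le[OF True \<open>0 < M\<close>, of "s + 1"] assms by simp
next
  case False
  then show ?thesis using assms by simp
qed

lemma sum_powr_all:
  assumes "s > 0"
  shows "(\<Sum>j<J. real (Suc j) powr (- s - 1)) \<le> 1 + 1 / s"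
proof -
  have "(\<Sum>j<J. real (Suc j) powr (- s - 1)) = (\<Sum>j=1..J. real j powr (- s - 1))"
    by (rule sum.reindex_bij_witness[of _ "\<lambda>j. j - 1" Suc]) auto
  also have "\<dots> \<le> 1 + 1 / s"
  proof (cases "J = 0")
    case False
    then have "(\<Sum>j=1..J. real j powr (- s - 1)) = 1 + (\<Sum>j=Suc 1..J. real j powr (- s - 1))"
      by (subst sum.atLeast_Suc_atMost) auto
    then show ?thesis using sum_powr_tail[of 1 s J] assms by simp
  qed (use assms in simp)
  finally show ?thesis .
qed

text \<open>In the \<open>i\<close>-th period \<open>[i L, (i + 1) L)\<close>, with \<open>L = 4 n + 2\<close>, the indices \<open>j \<ge> 2 n\<close> satisfy
  \<open>j \<ge> n (i + 1)\<close>, also for \<open>i = 0\<close>. So the power is at most \<open>n\<^bsup>-s-1\<^esup> (i + 1)\<^bsup>-s-1\<^esup>\<close>,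
  and the aliasing sums of the period contribute \<open>5 n\<close>.\<close>

lemma sum_powr_alias:
  assumes "n > 0" "s > 0"
  shows "(\<Sum>j=2 * n..N. real j powr (- s - 1) * \<bar>alias_sum n j\<bar>) \<le> 5 * (1 + 1 / s) * real n powr (- s)"
proof -
  define L where "L = 4 * n + 2"
  define h where "h j = (if j < 2 * n then 0 else real j powr (- s - 1) * \<bar>alias_sum n j\<bar>)" for j
  have h0: "0 \<le> h j" for j by (simp add: h_def)
  have "N < Suc N * L" by (simp add: L_def)
  have "(\<Sum>j=2 * n..N. real j powr (- s - 1) * \<bar>alias_sum n j\<bar>) = (\<Sum>j=2 * n..N. h j)"
    by (intro sum.cong) (auto simp: h_def)
  also have "\<dots> \<le> (\<Sum>j<Suc N * L. h j)"
    using \<open>N < Suc N * L\<close> h0 by (intro sum_mono2) auto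
  also have "\<dots> = (\<Sum>i<Suc N. \<Sum>j=i * L..<i * L + L. h j)"
    by (simp only: sum.nat_group)
  also have "\<dots> \<le> (\<Sum>i<Suc N. real n powr (- s - 1) * real (Suc i) powr (- s - 1) * (5 * real n))"
  proof (rule sum_mono)
    fix i
    let ?c = "real n powr (- s - 1) * real (Suc i) powr (- s - 1)"
    have "(\<Sum>j=i * L..<i * L + L. h j) = (\<Sum>m<L. h (m + i * L))"
      by (rule sum.reindex_bij_witness[of _ "\<lambda>m. m + i * L" "\<lambda>j. j - i * L"]) auto
    also have "\<dots> \<le> (\<Sum>m<L. ?c * \<bar>alias_sum n (m + i * L)\<bar>)"
    proof (rule sum_mono)
      fix m
      let ?j = "m + i * L"
      show "h ?j \<le> ?c * \<bar>alias_sum n ?j\<bar>"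
      proof (cases "?j < 2 * n")
        case False
        have "n * Suc i \<le> ?j"
          using False by (cases i) (auto simp: L_def algebra_simps)
        then have "real n * real (Suc i) \<le> real ?j" by (simp only: of_nat_mult[symmetric] of_nat_le_iff)
        then have "real ?j powr (- s - 1) \<le> (real n * real (Suc i)) powr (- s - 1)"
          using assms by (intro powr_mono2') (auto intro!: mult_pos_pos)
        also have "\<dots> = ?c" by (rule powr_mult) 
        finally show ?thesis using False by (simp add: h_def mult_right_mono)
      qed (simp add: h_def)
    qed
    also have "\<dots> = ?c * (\<Sum>m<L. \<bar>alias_sum n (m + i * L)\<bar>)" by (simp only: sum_distrib_left)
    also have "\<dots> \<le> ?c * (5 * real n)"
      unfolding L_def by (intro mult_left_mono sum_alias_shifted_period assms) simp
    finally show "(\<Sum>j=i * L..<i * L + L. h j) \<le> ?c * (5 * real n)" .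
  qed
  also have "\<dots> = 5 * (real n * real n powr (- s - 1)) * (\<Sum>i<Suc N. real (Suc i) powr (- s - 1))"
    by (simp only: sum_distrib_left) (simp only: mult_ac)
  also have "real n * real n powr (- s - 1) = real n powr (- s)"
    using assms powr_add[of "real n" 1 "- s - 1"] by simp
  also have "5 * real n powr (- s) * (\<Sum>i<Suc N. real (Suc i) powr (- s - 1)) \<le> 5 * real n powr (- s) * (1 + 1 / s)"
    by (intro mult_left_mono sum_powr_all assms) simp
  finally show ?thesis by (simp only: mult_ac)
qed

lemma sum_powr_div:
  assumes "n > 0" "s > 0"
  shows "(\<Sum>j=2 * n..N. real j powr (- s - 1) / real j) \<le> 1 / s * real n powr (- s - 1)"
proof -
  have "(\<Sum>j=2 * n..N. real j powr (- s - 1) / real j) \<le> (\<Sum>j=2 * n..N. real j powr (- s - 1) / real n)"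
    using assms by (intro sum_mono divide_left_mono) auto
  also have "\<dots> = (\<Sum>j=2 * n..N. real j powr (- s - 1)) / real n" by (simp add: sum_divide_distrib)
  also have "\<dots> \<le> (\<Sum>j=Suc n..N. real j powr (- s - 1)) / real n"
    using assms by (intro divide_right_mono sum_mono2) auto
  also have "\<dots> \<le> real n powr (- s) / s / real n"
    using assms by (intro divide_right_mono sum_powr_tail) auto
  also have "\<dots> = 1 / s * real n powr (- s - 1)"
    using assms powr_diff[of "real n" "- s" 1] by simp
  finally show ?thesis .
qed

text \<open>The sum is split at \<open>j = n\<^sup>2\<close>, where the two arguments of the minimum agree.\<close>

lemma sum_powr_min:
  assumes "n > 0" "s > 0"
  shows "(\<Sum>j=2 * n..N. real j powr (- s - 1) * min (real j / (real n)\<^sup>2) 1)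
    \<le> real n powr (-2) * (\<Sum>j=Suc n..n\<^sup>2. real j powr (- s)) + 1 / s * real n powr (-2 * s)"
proof -
  let ?h = "\<lambda>j. real j powr (- s - 1) * min (real j / (real n)\<^sup>2) 1"
  have h0: "0 \<le> ?h j" for j by simp
  have "(\<Sum>j=2 * n..N. ?h j) \<le> (\<Sum>j\<in>{Suc n..n\<^sup>2} \<union> {Suc (n\<^sup>2)..N}. ?h j)"
    using assms h0 by (intro sum_mono2) auto
  also have "\<dots> = (\<Sum>j=Suc n..n\<^sup>2. ?h j) + (\<Sum>j=Suc (n\<^sup>2)..N. ?h j)"
    by (rule sum.union_disjoint) auto
  also have "(\<Sum>j=Suc n..n\<^sup>2. ?h j) \<le> (\<Sum>j=Suc n..n\<^sup>2. real n powr (-2) * real j powr (- s))"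
  proof (rule sum_mono)
    fix j assume "j \<in> {Suc n..n\<^sup>2}"
    then have j: "real j > 0" by simp
    have "?h j \<le> real j powr (- s - 1) * (real j / (real n)\<^sup>2)" by (intro mult_left_mono) auto
    also have "\<dots> = real n powr (-2) * real j powr (- s)"
      using j assms powr_diff[of "real j" "- s" 1] powr_minus[of "real n" 2] by (simp add: field_simps)
    finally show "?h j \<le> real n powr (-2) * real j powr (- s)" .
  qed
  also have "\<dots> = real n powr (-2) * (\<Sum>j=Suc n..n\<^sup>2. real j powr (- s))" by (simp only: sum_distrib_left)
  also have "(\<Sum>j=Suc (n\<^sup>2)..N. ?h j) \<le> (\<Sum>j=Suc (n\<^sup>2)..N. real j powr (- s - 1))"
    by (intro sum_mono mult_left_le) auto
  also have "\<dots> \<le> real (n\<^sup>2) powr (- s) / s" using assms by (intro sum_powr_tail) auto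
  also have "real (n\<^sup>2) powr (- s) = real n powr (-2 * s)"
    using assms powr_powr[of "real n" 2 "- s"] by simp
  finally show ?thesis by simp
qed

text \<open>All three regimes come from this bound, which holds for every \<open>s > 0\<close>. It is proved for the partial
  sums of the Chebyshev series, uniformly in their length, and passes to the limit.\<close>

lemma gauss_error_general_bound:
  assumes "s > 0" "f \<in> X_space s" "is_sum_of_cheb_series f"
  obtains C where "C > 0" "eventually (\<lambda>n. \<bar>gauss_error n f\<bar> \<le> C * (real n powr (- s - 1)
      + real n powr (-2 * s) + real n powr (-2) * (\<Sum>j=Suc n..n\<^sup>2. real j powr (- s)))) sequentially"
proof -
  from assms(2) have "cheb_coeff f \<in> O(\<lambda>j. real j powr (- s - 1))" by (simp add: X_space_def)
  then obtain c where c: "c > 0" "eventually (\<lambda>j. norm (cheb_coeff f j) \<le> c * norm (real j powr (- s - 1))) sequentially"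
    by (rule landau_o.bigE)
  then obtain J where J: "\<And>j. j \<ge> J \<Longrightarrow> \<bar>cheb_coeff f j\<bar> \<le> c * real j powr (- s - 1)"
    by (auto simp: eventually_sequentially)
  define C where "C = c * (5 + 30 * (1 + 1 / s) + 4 / s + 5 / s)"
  have "\<bar>gauss_error n f\<bar> \<le> C * (real n powr (- s - 1) + real n powr (-2 * s)
      + real n powr (-2) * (\<Sum>j=Suc n..n\<^sup>2. real j powr (- s)))" (is "_ \<le> C * (?A + ?B + ?D)")
    if n: "n \<ge> max 1 J" for n
  proof -
    have n0: "n > 0" using n by simp
    have nonneg: "0 \<le> ?A" "0 \<le> ?B" "0 \<le> ?D" by (auto intro!: mult_nonneg_nonneg sum_nonneg)
    have fin: "\<bar>gauss_error n (cheb_partial_sum f N)\<bar> \<le> C * (?A + ?B + ?D)" for N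
    proof -
      let ?g = "\<lambda>j. real j powr (- s - 1)"
      have "\<bar>gauss_error n (cheb_partial_sum f N)\<bar>
          \<le> (\<Sum>j=2 * n..N. \<bar>cheb_coeff f j * gauss_error n (cheb_T j)\<bar>)"
        unfolding gauss_error_cheb_partial_sum[OF n0] by (rule sum_abs)
      also have "\<dots> \<le> (\<Sum>j=2 * n..N. c * (4 * (?g j / real j)
          + 6 / real n * (?g j * \<bar>alias_sum n j\<bar>) + 5 * (?g j * min (real j / (real n)\<^sup>2) 1)))"
      proof (rule sum_mono)
        fix j assume j: "j \<in> {2 * n..N}"
        have "\<bar>cheb_coeff f j * gauss_error n (cheb_T j)\<bar>
          \<le> c * ?g j * (4 / real j + 6 / real n * \<bar>alias_sum n j\<bar> + 5 * min (real j / (real n)\<^sup>2) 1)"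
          unfolding abs_mult using j n c(1)
          by (intro mult_mono J gauss_error_cheb_T_le n0) auto
        also have "\<dots> = c * (4 * (?g j / real j)
          + 6 / real n * (?g j * \<bar>alias_sum n j\<bar>) + 5 * (?g j * min (real j / (real n)\<^sup>2) 1))"
          by (simp add: algebra_simps)
        finally show "\<bar>cheb_coeff f j * gauss_error n (cheb_T j)\<bar> \<le> c * (4 * (?g j / real j)
          + 6 / real n * (?g j * \<bar>alias_sum n j\<bar>) + 5 * (?g j * min (real j / (real n)\<^sup>2) 1))" .
      qed
      also have "\<dots> = c * (4 * (\<Sum>j=2 * n..N. ?g j / real j)
          + 6 / real n * (\<Sum>j=2 * n..N. ?g j * \<bar>alias_sum n j\<bar>)
          + 5 * (\<Sum>j=2 * n..N. ?g j * min (real j / (real n)\<^sup>2) 1))"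
        by (simp only: sum_distrib_left[symmetric] sum.distrib)
      also have "\<dots> \<le> c * (4 * (1 / s * ?A) + 6 / real n * (5 * (1 + 1 / s) * real n powr (- s))
          + 5 * (?D + 1 / s * ?B))"
        using c(1) n0 assms(1)
        by (intro mult_left_mono add_mono sum_powr_div sum_powr_alias sum_powr_min) auto
      also have "6 / real n * (5 * (1 + 1 / s) * real n powr (- s)) = 30 * (1 + 1 / s) * ?A"
        using n0 powr_diff[of "real n" "- s" 1] by simp
      also have "c * (4 * (1 / s * ?A) + 30 * (1 + 1 / s) * ?A + 5 * (?D + 1 / s * ?B))
          \<le> C * (?A + ?B + ?D)"
      proof -
        have "0 \<le> 1 / s" using assms(1) by simp
        have "4 * (r * a) + 30 * (1 + r) * a + 5 * (d + r * b)
            \<le> (5 + 30 * (1 + r) + 4 * r + 5 * r) * (a + b + d)"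
          if "0 \<le> a" "0 \<le> b" "0 \<le> d" "0 \<le> r" for a b d r :: real
          using that mult_nonneg_nonneg[of r a] mult_nonneg_nonneg[of r b] mult_nonneg_nonneg[of r d]
          by (simp add: algebra_simps)
        from mult_left_mono[OF this[OF nonneg \<open>0 \<le> 1 / s\<close>], of c] c(1)
        show ?thesis by (simp add: C_def mult.assoc)
      qed
      finally show ?thesis .
    qed
    have "(\<lambda>N. gauss_error n (cheb_partial_sum f N)) \<longlonglongrightarrow> gauss_error n f"
      using assms(3) unfolding is_sum_of_cheb_series_def
      by (intro gauss_error_tendsto continuous_cheb_partial_sum)
    then have "(\<lambda>N. \<bar>gauss_error n (cheb_partial_sum f N)\<bar>) \<longlonglongrightarrow> \<bar>gauss_error n f\<bar>"
      by (rule tendsto_rabs)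
    then show ?thesis
      by (rule LIMSEQ_le_const2) (use fin in auto)
  qed
  then have "eventually (\<lambda>n. \<bar>gauss_error n f\<bar> \<le> C * (real n powr (- s - 1)
      + real n powr (-2 * s) + real n powr (-2) * (\<Sum>j=Suc n..n\<^sup>2. real j powr (- s)))) sequentially"
    unfolding eventually_sequentially by blast
  moreover have "C > 0" unfolding C_def using c(1) assms(1)
    by (intro mult_pos_pos add_pos_pos) auto
  ultimately show thesis using that by blast
qed

theorem theorem2p2:
  fixes s :: real and f :: "real \<Rightarrow> real"
  assumes "s > 0"
    and "f \<in> X_space s"
    and "is_sum_of_cheb_series f"
  shows "(s < 1 \<longrightarrow> (\<lambda>n. gauss_error n f) \<in> O(\<lambda>n. real n powr (-2 * s))) \<and>
         (s = 1 \<longrightarrow> (\<lambda>n. gauss_error n f) \<in> O(\<lambda>n. real n powr (-2) * ln (real n))) \<and>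
         (s > 1 \<longrightarrow> (\<lambda>n. gauss_error n f) \<in> O(\<lambda>n. real n powr (- s - 1)))"
proof -
  let ?D = "\<lambda>n. \<Sum>j=Suc n..n\<^sup>2. real j powr (- s)"
  obtain C where C: "C > 0" and ev: "eventually (\<lambda>n. \<bar>gauss_error n f\<bar> \<le> C * (real n powr (- s - 1)
      + real n powr (-2 * s) + real n powr (-2) * ?D n)) sequentially"
    by (rule gauss_error_general_bound[OF assms])
  have bigo: "(\<lambda>n. gauss_error n f) \<in> O(h)"
    if "c \<ge> 0" and h: "\<And>n. n \<ge> 3 \<Longrightarrow> real n powr (- s - 1) + real n powr (-2 * s) + real n powr (-2) * ?D n \<le> c * h n"
      and h0: "\<And>n. n \<ge> 3 \<Longrightarrow> 0 \<le> h n" for c h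
  proof (rule bigoI[where c = "C * c"])
    \<comment> \<open>From \<open>n = 3\<close> on \<open>ln n\<close> is at least \<open>1\<close>, which the case \<open>s = 1\<close> needs.\<close>
    show "eventually (\<lambda>n. norm (gauss_error n f) \<le> C * c * norm (h n)) sequentially"
      using ev eventually_ge_at_top[of 3]
    proof eventually_elim
      case (elim n)
      note elim(1)
      also have "C * (real n powr (- s - 1) + real n powr (-2 * s) + real n powr (-2) * ?D n) \<le> C * (c * h n)"
        using C h elim by (intro mult_left_mono) auto
      finally show ?case using h0[OF elim(2)] by (simp add: mult.assoc)
    qed
  qed
  have n_le: "n \<le> n\<^sup>2" for n :: nat by (simp add: power2_eq_square)
  show ?thesis
  proof (intro conjI impI)
    assume s: "s < 1"
    show "(\<lambda>n. gauss_error n f) \<in> O(\<lambda>n. real n powr (-2 * s))"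
    proof (rule bigo[where c = "2 + 1 / (1 - s)"])
      fix n :: nat assume n: "n \<ge> 3"
      have "?D n \<le> (real (n\<^sup>2) powr (1 - s) - real n powr (1 - s)) / (1 - s)"
        using n s assms(1) by (intro sum_powr_le n_le) auto
      also have "\<dots> \<le> real (n\<^sup>2) powr (1 - s) / (1 - s)"
        using s by (intro divide_right_mono) auto
      also have "real (n\<^sup>2) powr (1 - s) = real n powr (2 - 2 * s)"
        using n powr_powr[of "real n" 2 "1 - s"] by (simp add: algebra_simps)
      finally have "real n powr (-2) * ?D n \<le> real n powr (-2) * (real n powr (2 - 2 * s) / (1 - s))"
        by (intro mult_left_mono) auto
      also have "\<dots> = real n powr (-2 * s) / (1 - s)"
        by (simp flip: powr_add)
      finally have "real n powr (-2) * ?D n \<le> 1 / (1 - s) * real n powr (-2 * s)" by simp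
      moreover have "real n powr (- s - 1) \<le> real n powr (-2 * s)"
        using n s by (intro powr_mono) auto
      ultimately show "real n powr (- s - 1) + real n powr (-2 * s) + real n powr (-2) * ?D n
          \<le> (2 + 1 / (1 - s)) * real n powr (-2 * s)" by (simp only: distrib_right)
    qed (use s in auto)
  next
    assume s: "s = 1"
    show "(\<lambda>n. gauss_error n f) \<in> O(\<lambda>n. real n powr (-2) * ln (real n))"
    proof (rule bigo[where c = 4])
      fix n :: nat assume n: "n \<ge> 3"
      have "?D n \<le> ln (real (n\<^sup>2)) - ln (real n)"
      proof (rule sum_le_antiderivative[OF n_le])
        fix x :: real assume "real n \<le> x"
        then have x: "x > 0" using n by linarith
        then show "(ln has_real_derivative x powr - s) (at x)"
          using DERIV_ln[OF x] by (simp add: s powr_minus)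
        show "y powr - s \<le> x powr - s" if "x \<le> y" for y
          using x that assms(1) by (intro powr_mono2') auto
      qed (use n in simp)
      also have "\<dots> \<le> 2 * ln (real n)" using n by (simp add: ln_realpow)
      finally have "real n powr (-2) * ?D n \<le> real n powr (-2) * (2 * ln (real n))"
        by (intro mult_left_mono) auto
      moreover have "1 \<le> ln (real n)"
      proof -
        have "exp 1 \<le> real n" using n exp_le by linarith
        then show ?thesis using n by (simp add: ln_ge_iff)
      qed
      then have "real n powr (-2) * 1 \<le> real n powr (-2) * ln (real n)" by (intro mult_left_mono) auto
      moreover have "- s - 1 = -2" "-2 * s = -2" using s by auto
      ultimately show "real n powr (- s - 1) + real n powr (-2 * s) + real n powr (-2) * ?D n
          \<le> 4 * (real n powr (-2) * ln (real n))" by simp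
    qed auto
  next
    assume s: "s > 1"
    show "(\<lambda>n. gauss_error n f) \<in> O(\<lambda>n. real n powr (- s - 1))"
    proof (rule bigo[where c = "2 + 1 / (s - 1)"])
      fix n :: nat assume n: "n \<ge> 3"
      have "?D n \<le> real n powr (- (s - 1)) / (s - 1)"
        using sum_powr_tail[of n "s - 1" "n\<^sup>2"] n s by simp
      then have "real n powr (-2) * ?D n \<le> real n powr (-2) * (real n powr (- (s - 1)) / (s - 1))"
        by (intro mult_left_mono) auto
      also have "\<dots> = real n powr (-2 + - (s - 1)) / (s - 1)"
        by (simp only: powr_add times_divide_eq_right)
      also have "-2 + - (s - 1) = - s - 1" by simp
      also have "real n powr (- s - 1) / (s - 1) = 1 / (s - 1) * real n powr (- s - 1)" by simp
      finally have "real n powr (-2) * ?D n \<le> 1 / (s - 1) * real n powr (- s - 1)" .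
      moreover have "real n powr (-2 * s) \<le> real n powr (- s - 1)"
        using n s by (intro powr_mono) auto
      ultimately show "real n powr (- s - 1) + real n powr (-2 * s) + real n powr (-2) * ?D n
          \<le> (2 + 1 / (s - 1)) * real n powr (- s - 1)" by (simp only: distrib_right)
    qed (use s in auto)
  qed
qed

end
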